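(* Let $\mathcal{A}$ be a hyperplane arrangement in $V=\mathbb{R}^n$ with set of chambers $\mathcal{C}_{\mathcal{A}}$, and let $w$ be a probability measure on its set of faces $\mathcal{F}_{\mathcal{A}}$. Let $\mathcal{B}\subseteq\mathcal{A}$ be a subarrangement with set of chambers $\mathcal{C}_{\mathcal{B}}$ and intersection poset $\mathcal{L}_{\mathcal{B}}$, and let $K^*$ be the transition matrix of the Markov chain on $\mathcal{C}_{\mathcal{B}}$ induced (via $C\mapsto\overline{C}$) from the hyperplane walk on $\mathcal{A}$ associated to $w$. (i) The characteristic polynomial of $K^*$ is $$\det(xI-K^* )=\prod_{W\in\mathcal{L}_{\mathcal{B}}}(x-\lambda_W)^{m^*_W},$$ where $\lambda_W=\sum_{F\in\mathcal{F}_{\mathcal{A}}:\,F\subseteq W}w(F)$ and $m^*_W=|\mu_{\mathcal{B}}(V,W)|=(-1)^{\mathrm{codim}(W,V)}\mu_{\mathcal{B}}(V,W)$, with $\mu_{\mathcal{B}}$ the Möbius function of $\mathcal{L}_{\mathcal{B}}$. (ii) $K^*$ is diagonalizable. (iii) $K^*$ has a unique stationary distribution $\bar\pi$ if and only if for every $H\in\mathcal{B}$ there exists a face $F\in\mathcal{F}_{\mathcal{A}}$ with $F\not\subseteq H$ and $w(F)>0$. Moreover, if $w$ is separating, so that the hyperplane walk on $\mathcal{A}$ has a unique stationary distribution $\pi$, then $\bar\pi(D)=\sum_{C\in\mathcal{C}_{\mathcal{A}}:\,C\subseteq D}\pi(C)$ for every $D\in\mathcal{C}_{\mathcal{B}}$.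 (iv) Assume $\bar\pi$ exists and let $(K^*_D)^l$ be the distribution after $l$ steps of the induced chain started at $D\in\mathcal{C}_{\mathcal{B}}$. Then $$\|(K^*_D)^l-\bar\pi\|_{\mathrm{TV}}\le P\Big(F_1F_2\cdots F_l\subseteq\bigcup_{H\in\mathcal{B}}H\Big),$$ where $F_1,F_2,\dots$ are independent picks from $w$, and $$\|(K^*_D)^l-\bar\pi\|_{\mathrm{TV}}\le\sum_{H\in\mathcal{B}}\lambda_H^l.$$
   Context: A hyperplane arrangement $\mathcal{A}$ in $V=\mathbb{R}^n$ is a finite set of affine hyperplanes. Its chambers are the connected components of $V\setminus\bigcup_{H\in\mathcal{A}}H$. The intersection poset $\mathcal{L}_{\mathcal{A}}$ is the set of all (nonempty) intersections of subsets of $\mathcal{A}$ (empty intersection $=V$), ordered by reverse inclusion; $V$ is its minimum. For $W\in\mathcal{L}_{\mathcal{A}}$, the restriction of $\mathcal{A}$ to $W$ is the arrangement in $W$ of the intersections $W\cap H$ with $H\in\mathcal{A}$ not parallel to $W$ (in particular not containing $W$); the chambers of all these restrictions are the faces of $\mathcal{A}$, with set $\mathcal{F}_{\mathcal{A}}$. For faces $F,G$, pick $x\in F$, $y\in G$; the product $FG$ is the face containing $x+\epsilon(y-x)$ for all sufficiently small $\epsilon>0$ (this product is associative); $FC$ is a chamber whenever $C$ is. Given a probability measure $w$ on $\mathcal{F}_{\mathcal{A}}$, the hyperplane walk on $\mathcal{A}$ associated to $w$ is the Markov chain on $\mathcal{C}_{\mathcal{A}}$ with transition matrix $K(C,C')=\sum_{F:\,FC=C'}w(F)$.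 The measure $w$ is separating if for every $H\in\mathcal{A}$ there is $F\in\mathcal{F}_{\mathcal{A}}$ with $F\not\subseteq H$ and $w(F)>0$. For a subarrangement $\mathcal{B}$, each chamber $C$ of $\mathcal{A}$ lies in a unique chamber $\overline{C}$ of $\mathcal{B}$, and the process $\overline{X_t}$ induced from the walk $X_t$ is a Markov chain on $\mathcal{C}_{\mathcal{B}}$. For a hyperplane $H\in\mathcal{B}$, $\lambda_H$ denotes $\lambda_W$ with $W=H$. The total variation distance is $\|P-Q\|_{\mathrm{TV}}=\max_{A}|P(A)-Q(A)|$. *)

theory Defs
  imports
    "HOL-Analysis.Analysis"
    "HOL-Probability.Probability"
    "Jordan_Normal_Form.Char_Poly"
begin

definition is_hyperplane :: "(real ^ 'n) set \<Rightarrow> bool" where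
  "is_hyperplane H \<longleftrightarrow> (\<exists>a b. a \<noteq> 0 \<and> H = {x. inner a x = b})"

definition arrangement :: "(real ^ 'n) set set \<Rightarrow> bool" where
  "arrangement A \<longleftrightarrow> finite A \<and> (\<forall>H\<in>A. is_hyperplane H)"

definition chambers :: "(real ^ 'n) set set \<Rightarrow> (real ^ 'n) set set" where
  "chambers A = components (UNIV - \<Union>A)"

text \<open>The case \<open>S = {}\<close> contributes \<open>\<Inter>{} = UNIV\<close>, the minimum of the poset.\<close>

definition intersection_poset :: "(real ^ 'n) set set \<Rightarrow> (real ^ 'n) set set" where
  "intersection_poset A = {\<Inter>S | S. S \<subseteq> A \<and> \<Inter>S \<noteq> {}}"

text \<open>
  A flat \<open>W\<close> of arbitrary dimension is parallel to \<open>H\<close> if some translate of \<open>W\<close> lies in \<open>H\<close>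
  (so a subset of \<open>H\<close> is parallel to \<open>H\<close>).  The library's \<open>affine_parallel\<close> only relates
  flats of equal dimension.
\<close>

definition parallel_to :: "(real ^ 'n) set \<Rightarrow> (real ^ 'n) set \<Rightarrow> bool" where
  "parallel_to W H \<longleftrightarrow> (\<exists>a. (+) a ` W \<subseteq> H)"

definition restriction :: "(real ^ 'n) set set \<Rightarrow> (real ^ 'n) set \<Rightarrow> (real ^ 'n) set set" where
  "restriction A W = {W \<inter> H | H. H \<in> A \<and> \<not> parallel_to W H}"

definition faces :: "(real ^ 'n) set set \<Rightarrow> (real ^ 'n) set set" where
  "faces A = (\<Union>W\<in>intersection_poset A. components (W - \<Union>(restriction A W)))"

text \<open>
  The face does not depend on the chosen points \<open>x \<in> F\<close>, \<open>y \<in> G\<close>, so quantifying over all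
  of them describes the same face as picking one pair.
\<close>

definition face_prod :: "(real ^ 'n) set set \<Rightarrow> (real ^ 'n) set \<Rightarrow> (real ^ 'n) set \<Rightarrow> (real ^ 'n) set" where
  "face_prod A F G = (THE K. K \<in> faces A \<and>
     (\<forall>x\<in>F. \<forall>y\<in>G. \<forall>\<^sub>F e in at_right (0::real). x + e *\<^sub>R (y - x) \<in> K))"

text \<open>Product of a nonempty list of faces; it has no meaning for the empty list, since an affine
  arrangement need not have an identity face.\<close>

definition face_prod_list :: "(real ^ 'n) set set \<Rightarrow> (real ^ 'n) set list \<Rightarrow> (real ^ 'n) set" where
  "face_prod_list A Fs = foldl (face_prod A) (hd Fs) (tl Fs)"

text \<open>
  Moebius function of a finite set \<open>L\<close> of sets ordered by reverse inclusion, i.e. \<open>U\<close> is below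
  \<open>W\<close> iff \<open>W \<subseteq> U\<close>:  \<open>\<mu>(U,U) = 1\<close>  and  \<open>\<mu>(U,W) = - (\<Sum>Z. U \<le> Z < W. \<mu>(U,Z))\<close>  for \<open>U < W\<close>.
\<close>

function poset_moebius :: "'a set set \<Rightarrow> 'a set \<Rightarrow> 'a set \<Rightarrow> int" where
  "poset_moebius L U W =
     (if finite L \<and> U \<in> L \<and> W \<in> L \<and> W \<subseteq> U
      then if W = U then 1 else - (\<Sum>Z\<in>{Z \<in> L. Z \<subseteq> U \<and> W \<subset> Z}. poset_moebius L U Z)
      else 0)"
  by pat_completeness auto
termination
proof (relation "Wellfounded.measure (\<lambda>(L, U, W). card {Z \<in> L. W \<subset> Z})", goal_cases)
  case 1
  then show ?case by simp
next
  case (2 L U W Z)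
  then have "{Z' \<in> L. Z \<subset> Z'} \<subset> {Z' \<in> L. W \<subset> Z'}" by auto
  with 2 show ?case by (auto intro!: psubset_card_mono)
qed

declare poset_moebius.simps [simp del]

definition codim :: "(real ^ 'n) set \<Rightarrow> nat" where
  "codim W = nat (aff_dim (UNIV :: (real ^ 'n) set) - aff_dim W)"

definition walk_kernel ::
  "(real ^ 'n) set set \<Rightarrow> (real ^ 'n) set pmf \<Rightarrow> (real ^ 'n) set \<Rightarrow> (real ^ 'n) set \<Rightarrow> real" where
  "walk_kernel A w C C' = (\<Sum>F\<in>{F \<in> faces A. face_prod A F C = C'}. pmf w F)"

definition separating :: "(real ^ 'n) set set \<Rightarrow> (real ^ 'n) set pmf \<Rightarrow> bool" where
  "separating A w \<longleftrightarrow> (\<forall>H\<in>A. \<exists>F\<in>faces A. \<not> F \<subseteq> H \<and> pmf w F > 0)"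

definition chamber_containing :: "(real ^ 'n) set set \<Rightarrow> (real ^ 'n) set \<Rightarrow> (real ^ 'n) set" where
  "chamber_containing B C = (THE D. D \<in> chambers B \<and> C \<subseteq> D)"

text \<open>
  One-step transition probability \<open>P(overline X\<^sub>1 = D' | X\<^sub>0 = C)\<close> for a chamber \<open>C\<close> of \<open>A\<close> with
  \<open>overline C = D\<close>.  Because the induced process is a Markov chain for every starting chamber,
  this number is the same for every such \<open>C\<close>, and the choice operator is immaterial.
\<close>

definition induced_kernel ::
  "(real ^ 'n) set set \<Rightarrow> (real ^ 'n) set set \<Rightarrow> (real ^ 'n) set pmf \<Rightarrow>
   (real ^ 'n) set \<Rightarrow> (real ^ 'n) set \<Rightarrow> real" where
  "induced_kernel A B w D D' =
     (let C = (SOME C. C \<in> chambers A \<and> chamber_containing B C = D)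
      in \<Sum>C'\<in>{C' \<in> chambers A. chamber_containing B C' = D'}. walk_kernel A w C C')"

definition face_mass :: "(real ^ 'n) set set \<Rightarrow> (real ^ 'n) set pmf \<Rightarrow> (real ^ 'n) set \<Rightarrow> real" where
  "face_mass A w W = (\<Sum>F\<in>{F \<in> faces A. F \<subseteq> W}. pmf w F)"

text \<open>Row \<open>i\<close>, column \<open>j\<close> is the transition probability from state \<open>e i\<close> to state \<open>e j\<close>.\<close>

definition kernel_mat :: "nat \<Rightarrow> (nat \<Rightarrow> 's) \<Rightarrow> ('s \<Rightarrow> 's \<Rightarrow> real) \<Rightarrow> real Matrix.mat" where
  "kernel_mat N e K = Matrix.mat N N (\<lambda>(i, j). K (e i) (e j))"

definition diagonalizable :: "'a::field Matrix.mat \<Rightarrow> bool" where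
  "diagonalizable M \<longleftrightarrow> (\<exists>D. diagonal_mat D \<and> similar_mat M D)"

definition stationary :: "'s set \<Rightarrow> ('s \<Rightarrow> 's \<Rightarrow> real) \<Rightarrow> 's pmf \<Rightarrow> bool" where
  "stationary S K p \<longleftrightarrow> set_pmf p \<subseteq> S \<and> (\<forall>y\<in>S. (\<Sum>x\<in>S. pmf p x * K x y) = pmf p y)"

primrec kernel_pow :: "'s set \<Rightarrow> ('s \<Rightarrow> 's \<Rightarrow> real) \<Rightarrow> nat \<Rightarrow> 's \<Rightarrow> 's \<Rightarrow> real" where
  "kernel_pow S K 0 x y = (if x = y then 1 else 0)"
| "kernel_pow S K (Suc l) x y = (\<Sum>z\<in>S. kernel_pow S K l x z * K z y)"

definition tv_dist :: "'s set \<Rightarrow> ('s \<Rightarrow> real) \<Rightarrow> ('s \<Rightarrow> real) \<Rightarrow> real" where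
  "tv_dist S p q = Max ((\<lambda>E. \<bar>sum p E - sum q E\<bar>) ` Pow S)"

end

theory Submission
  imports Defs "Jordan_Normal_Form.Jordan_Normal_Form_Existence"
begin

text \<open>
  Faces are cells of equal sign vectors, the face product is composition of sign vectors, and
  the induced chain is the walk in which the faces of \<open>A\<close> act directly on the chambers of \<open>B\<close>.

  Let \<open>T\<^sub>g\<close> be the operator of a word \<open>g\<close> of faces. A face contained in every hyperplane of \<open>B\<close>
  that contains all letters of \<open>g\<close> is absorbed by \<open>g\<close>; with \<open>\<lambda>\<^sub>g\<close> the total weight of these faces,
  \<open>K T\<^sub>g - \<lambda>\<^sub>g T\<^sub>g\<close> is a combination of operators \<open>T\<^sub>g\<^sub>F\<close> with \<open>\<lambda>\<^sub>g\<^sub>F > \<lambda>\<^sub>g\<close>. Hence the eigenvalues are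
  real and there are no nontrivial Jordan chains. The trace of \<open>T\<^sub>g\<close> counts the chambers fixed by
  \<open>g\<close>, that is, the chambers of the localization at \<open>g\<close>, which by Zaslavsky's theorem is a sum of
  values \<open>|\<mu>|\<close>; so the traces of all powers of \<open>K\<close>, and with them the multiplicities, are known.

  Convergence is a coupling argument: a word that is not contained in any hyperplane of \<open>B\<close> sends
  all chambers to one.
\<close>

section \<open>Faces and sign vectors\<close>

text \<open>The faces of an affine arrangement need not include an identity; words supply one, since
  the empty word acts trivially, and statements about a vector are read off there. The system of
  words is only triangular, and different flats may have equal mass, so eigenspaces are not counted
  flat by flat. Instead, strict growth of masses excludes Jordan chains for repeated eigenvalues,
  and the traces of all powers then give the multiplicities, with equal eigenvalues grouped. A
  Jordan form over the reals presupposes a characteristic polynomial that splits, hence the separate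
  argument, over the complex numbers, that eigenvalues are real. Traces of powers are found one
  letter at a time: appending \<open>F\<close> to a word cuts the flats down to those containing
  \<open>F\<close>, and averaging over \<open>F\<close> yields one more factor
  \<open>\<lambda>_W\<close>.\<close>

lemma arrangementD:
  assumes "arrangement A"
  shows "finite A" "\<And>H. H \<in> A \<Longrightarrow> is_hyperplane H"
  using assms by (auto simp: arrangement_def)

lemma arrangement_subset: "arrangement A \<Longrightarrow> B \<subseteq> A \<Longrightarrow> arrangement B"
  by (auto simp: arrangement_def intro: finite_subset)

text \<open>A hyperplane determines its equation only up to a nonzero factor. The choice fixes one,
  and with it an orientation that depends on \<open>H\<close> alone and is therefore shared by
  \<open>A\<close> and its subarrangements.\<close>

definition hyp_fun :: "(real ^ 'n) set \<Rightarrow> real ^ 'n \<Rightarrow> real" where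
  "hyp_fun H = (SOME f. \<exists>a b. a \<noteq> 0 \<and> f = (\<lambda>x. inner a x - b) \<and> H = {x. inner a x = b})"

definition side :: "(real ^ 'n) set \<Rightarrow> real ^ 'n \<Rightarrow> real" where
  "side H x = sgn (hyp_fun H x)"

text \<open>Indexed by a point, so only realizable sign vectors occur. Points on hyperplanes are
  allowed, which lets faces and chambers be treated alike.\<close>

definition cell :: "(real ^ 'n) set set \<Rightarrow> real ^ 'n \<Rightarrow> (real ^ 'n) set" where
  "cell B x = {y. \<forall>H\<in>B. side H y = side H x}"

lemma hyp_fun_obtain:
  assumes "is_hyperplane H"
  obtains a b where "a \<noteq> 0" "hyp_fun H = (\<lambda>x. inner a x - b)" "H = {x. inner a x = b}"
proof -
  have "\<exists>f a b. a \<noteq> 0 \<and> f = (\<lambda>x. inner a x - b) \<and> H = {x. inner a x = b}"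
    using assms unfolding is_hyperplane_def by blast
  from someI_ex[OF this] that show thesis unfolding hyp_fun_def by blast
qed

lemma side_eq_0_iff: "is_hyperplane H \<Longrightarrow> side H x = 0 \<longleftrightarrow> x \<in> H"
  by (erule hyp_fun_obtain) (auto simp: side_def sgn_0_0)

lemma side_eq_imp_mem_iff: "is_hyperplane H \<Longrightarrow> side H y = side H x \<Longrightarrow> y \<in> H \<longleftrightarrow> x \<in> H"
  by (metis side_eq_0_iff)

lemma side_cases: "side H x = 0 \<or> side H x = 1 \<or> side H x = - 1"
  by (simp add: side_def sgn_if)

lemma side_attained:
  assumes H: "is_hyperplane H" and s: "s = 1 \<or> s = - 1"
  shows "\<exists>p. side H p = s"
proof -
  obtain a b where ab: "a \<noteq> 0" "hyp_fun H = (\<lambda>x. inner a x - b)" using hyp_fun_obtain[OF H] .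
  have "side H (((b + s) / inner a a) *\<^sub>R a) = sgn s" using ab by (simp add: side_def)
  then show ?thesis using s by (intro exI[of _ "((b + s) / inner a a) *\<^sub>R a"]) auto
qed

lemma hyp_fun_segment:
  assumes "is_hyperplane H"
  shows "hyp_fun H (x + e *\<^sub>R (y - x)) = hyp_fun H x + e * (hyp_fun H y - hyp_fun H x)"
  using assms by (elim hyp_fun_obtain) (simp add: inner_add_right inner_diff_right algebra_simps)

text \<open>Along the segment the equation is affine in \<open>e\<close>: a nonzero value at
  \<open>x\<close> keeps its sign by continuity, a zero value leaves \<open>e * hyp_fun H y\<close>.
  All products of faces come from this rule.\<close>

lemma side_segment:
  assumes H: "is_hyperplane H"
  shows "\<forall>\<^sub>F e in at_right 0. side H (x + e *\<^sub>R (y - x)) = (if side H x = 0 then side H y else side H x)"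
proof (cases "hyp_fun H x = 0")
  case True
  have "\<forall>\<^sub>F e::real in at_right 0. e > 0"
    by (simp add: eventually_at_right_less)
  then show ?thesis
    by eventually_elim (simp add: side_def hyp_fun_segment[OF H] True sgn_mult)
next
  case False
  have "((\<lambda>e. hyp_fun H x + e * (hyp_fun H y - hyp_fun H x)) \<longlongrightarrow>
      hyp_fun H x + 0 * (hyp_fun H y - hyp_fun H x)) (at_right 0)"
    by (intro tendsto_intros)
  then have lim: "((\<lambda>e. hyp_fun H (x + e *\<^sub>R (y - x))) \<longlongrightarrow> hyp_fun H x) (at_right 0)"
    by (simp add: hyp_fun_segment[OF H])
  show ?thesis
  proof (cases "hyp_fun H x > 0")
    case True
    from order_tendstoD(1)[OF lim True] show ?thesis
      by eventually_elim (use True in \<open>simp add: side_def\<close>)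
  next
    case neg: False
    with False have neg: "hyp_fun H x < 0" by simp
    from order_tendstoD(2)[OF lim neg] show ?thesis
      by eventually_elim (use neg in \<open>simp add: side_def\<close>)
  qed
qed

lemma sides_segment:
  assumes "arrangement A"
  shows "\<forall>\<^sub>F e in at_right 0. \<forall>H\<in>A. side H (x + e *\<^sub>R (y - x)) = (if side H x = 0 then side H y else side H x)"
  using arrangementD[OF assms] by (intro eventually_ball_finite ballI side_segment) blast+

lemma segment_avoids:
  assumes "is_hyperplane H" "side H z = (if side H x = 0 then side H y else side H x)" "x \<notin> H \<or> y \<notin> H"
  shows "z \<notin> H"
  using assms(2,3) side_eq_0_iff[OF assms(1)] by metis

lemma convex_side:
  assumes "is_hyperplane H"
  shows "convex {y. side H y = s}"
proof -
  obtain a b where ab: "hyp_fun H = (\<lambda>x. inner a x - b)" using hyp_fun_obtain[OF assms] .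
  consider "s = 0" | "s = 1" | "s = -1" | "{y. side H y = s} = {}"
    using side_cases[of H] by blast
  then show ?thesis
  proof cases
    case 1
    then have "{y. side H y = s} = {y. inner a y = b}" by (auto simp: side_def ab sgn_0_0)
    then show ?thesis by (simp add: convex_hyperplane)
  next
    case 2
    then have "{y. side H y = s} = {y. inner a y > b}" by (auto simp: side_def ab sgn_1_pos)
    then show ?thesis by (simp add: convex_halfspace_gt)
  next
    case 3
    then have "{y. side H y = s} = {y. inner a y < b}" by (auto simp: side_def ab sgn_1_neg)
    then show ?thesis by (simp add: convex_halfspace_lt)
  qed simp
qed

lemma convex_cell:
  assumes "\<And>H. H \<in> B \<Longrightarrow> is_hyperplane H"
  shows "convex (cell B x)"
proof -
  have "cell B x = (\<Inter>H\<in>B. {y. side H y = side H x})" by (auto simp: cell_def)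
  then show ?thesis using assms by (auto intro!: convex_INT convex_side)
qed

lemma connected_side_const:
  assumes H: "is_hyperplane H" and T: "connected T" "T \<inter> H = {}" and x: "x \<in> T" "y \<in> T"
  shows "side H x = side H y"
proof -
  obtain a b where ab: "hyp_fun H = (\<lambda>x. inner a x - b)" "H = {x. inner a x = b}"
    using hyp_fun_obtain[OF H] .
  have False if "inner a u \<le> b" "b \<le> inner a v" "u \<in> T" "v \<in> T" for u v
    using connected_ivt_hyperplane[OF T(1) that(3,4,1,2)] T(2) ab by auto
  from this[of x y] this[of y x] x T(2) ab show ?thesis
    by (force simp: side_def sgn_if)
qed

lemma cell_self [simp]: "x \<in> cell B x" by (simp add: cell_def)

lemma cell_eqI: "y \<in> cell B x \<Longrightarrow> cell B y = cell B x" by (auto simp: cell_def)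

lemma cell_eq_iff: "cell B y = cell B x \<longleftrightarrow> (\<forall>H\<in>B. side H y = side H x)"
  by (auto simp: cell_def)

text \<open>Cells are convex, hence connected, and a connected subset of \<open>U\<close> cannot
  cross a hyperplane that misses \<open>U\<close>. A general \<open>U\<close> covers both the
  complement of all hyperplanes and the open strata of flats.\<close>

lemma components_eq_cells:
  assumes hyp: "\<And>H. H \<in> A \<Longrightarrow> is_hyperplane H"
    and U: "\<And>H. H \<in> A \<Longrightarrow> U \<subseteq> H \<or> U \<inter> H = {}"
    and closed: "\<And>x. x \<in> U \<Longrightarrow> cell A x \<subseteq> U"
  shows "components U = cell A ` U"
proof -
  have "connected_component_set U x = cell A x" if x: "x \<in> U" for x
  proof (rule connected_component_unique)
    show "x \<in> cell A x" "cell A x \<subseteq> U" "connected (cell A x)"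
      using closed[OF x] convex_cell[of A] hyp by (auto intro: convex_connected)
    fix T assume T: "x \<in> T" "T \<subseteq> U" "connected T"
    show "T \<subseteq> cell A x"
    proof
      fix y assume y: "y \<in> T"
      have "side H y = side H x" if H: "H \<in> A" for H
      proof (cases "U \<subseteq> H")
        case True
        then show ?thesis using T y side_eq_0_iff[OF hyp[OF H]] by (metis subsetD)
      next
        case False
        with U[OF H] T have "T \<inter> H = {}" by blast
        with connected_side_const[OF hyp[OF H]] T y show ?thesis by blast
      qed
      then show "y \<in> cell A x" by (simp add: cell_def)
    qed
  qed
  then show ?thesis unfolding components_def by auto
qed

lemma chambers_eq_cells:
  assumes "\<And>H. H \<in> B \<Longrightarrow> is_hyperplane H"
  shows "chambers B = cell B ` (UNIV - \<Union>B)"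
  unfolding chambers_def
proof (rule components_eq_cells[OF assms])
  fix x assume x: "x \<in> UNIV - \<Union>B"
  have "y \<notin> H" if "y \<in> cell B x" "H \<in> B" for y H
    using that x side_eq_imp_mem_iff[OF assms[OF that(2)], of y x] by (auto simp: cell_def)
  then show "cell B x \<subseteq> UNIV - \<Union>B" by blast
qed auto

text \<open>If a translate of \<open>W\<close> lies in \<open>H\<close> and the two share a point,
  the translation vector is orthogonal to the normal of \<open>H\<close>.\<close>

lemma parallel_to_iff_subset:
  assumes "is_hyperplane H"
  shows "x \<in> W \<Longrightarrow> x \<in> H \<Longrightarrow> parallel_to W H \<longleftrightarrow> W \<subseteq> H"
proof -
  have "W \<subseteq> H" if p: "parallel_to W H" and x: "x \<in> W" "x \<in> H" for x
  proof
    fix y assume y: "y \<in> W"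
    from p obtain t where t: "(+) t ` W \<subseteq> H" unfolding parallel_to_def ..
    obtain a b where H: "H = {x. inner a x = b}" using hyp_fun_obtain[OF assms] .
    from t x y have "t + x \<in> H" "t + y \<in> H" by auto
    with x H show "y \<in> H" by (simp add: inner_add_right)
  qed
  moreover have "parallel_to W H" if "W \<subseteq> H"
    unfolding parallel_to_def using that by (intro exI[of _ 0]) auto
  ultimately show "x \<in> W \<Longrightarrow> x \<in> H \<Longrightarrow> parallel_to W H \<longleftrightarrow> W \<subseteq> H" by blast
qed

text \<open>A hyperplane that is parallel to \<open>W\<close> without containing it misses
  \<open>W\<close>, so removing it changes nothing.\<close>

lemma restriction_complement:
  assumes "\<And>H. H \<in> A \<Longrightarrow> is_hyperplane H"
  shows "W - \<Union>(restriction A W) = W - \<Union>{H \<in> A. \<not> W \<subseteq> H}"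
proof -
  have "x \<in> \<Union>(restriction A W) \<longleftrightarrow> x \<in> \<Union>{H \<in> A. \<not> W \<subseteq> H}" if x: "x \<in> W" for x
  proof -
    have "x \<in> \<Union>(restriction A W) \<longleftrightarrow> (\<exists>H\<in>A. x \<in> H \<and> \<not> parallel_to W H)"
      using x by (auto simp: restriction_def)
    also have "\<dots> \<longleftrightarrow> (\<exists>H\<in>A. x \<in> H \<and> \<not> W \<subseteq> H)"
      using parallel_to_iff_subset[OF assms x] by blast
    finally show ?thesis by blast
  qed
  then show ?thesis by blast
qed

lemma faces_eq_cells:
  assumes hyp: "\<And>H. H \<in> A \<Longrightarrow> is_hyperplane H"
  shows "faces A = range (cell A)"
proof -
  define U where "U W = W - \<Union>{H \<in> A. \<not> W \<subseteq> H}" for W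
  have mem: "y \<in> H \<longleftrightarrow> x \<in> H" if "y \<in> cell A x" "H \<in> A" for x y H
    using side_eq_imp_mem_iff[OF hyp[OF that(2)], of y x] that by (simp add: cell_def)
  have closed: "cell A x \<subseteq> U (\<Inter>S)" if S: "S \<subseteq> A" and x: "x \<in> U (\<Inter>S)" for S x
  proof
    fix y assume y: "y \<in> cell A x"
    have "y \<in> H" if H: "H \<in> S" for H
      using mem[OF y, of H] H S x by (auto simp: U_def)
    moreover have "y \<notin> H" if H: "H \<in> A" "\<not> \<Inter>S \<subseteq> H" for H
    proof -
      have "x \<notin> H" using x H by (auto simp: U_def)
      then show ?thesis using mem[OF y H(1)] by simp
    qed
    ultimately show "y \<in> U (\<Inter>S)" unfolding U_def by blast
  qed
  have comp: "components (U W) = cell A ` U W" if W: "W \<in> intersection_poset A" for W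
  proof -
    have "\<exists>S. W = \<Inter>S \<and> S \<subseteq> A \<and> \<Inter>S \<noteq> {}"
      using W unfolding intersection_poset_def by (rule CollectD)
    then have "cell A x \<subseteq> U W" if "x \<in> U W" for x using closed that by blast
    moreover have "U W \<subseteq> H \<or> U W \<inter> H = {}" if "H \<in> A" for H
      using that unfolding U_def by blast
    ultimately show ?thesis using hyp by (intro components_eq_cells)
  qed
  \<comment> \<open>Every point lies in the open stratum of the smallest flat through it, the
    intersection of all hyperplanes that contain it.\<close>
  have "\<exists>W\<in>intersection_poset A. x \<in> U W" for x
  proof
    show "x \<in> U (\<Inter>{H \<in> A. x \<in> H})" by (auto simp: U_def)
    show "\<Inter>{H \<in> A. x \<in> H} \<in> intersection_poset A"
      unfolding intersection_poset_def by blast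
  qed
  moreover have "W - \<Union>(restriction A W) = U W" for W
    unfolding U_def by (rule restriction_complement) (rule hyp)
  then have "faces A = (\<Union>W\<in>intersection_poset A. cell A ` U W)"
    unfolding faces_def
    by (simp add: comp)
  ultimately show ?thesis by blast
qed

lemma arrangement_faces: "arrangement A \<Longrightarrow> faces A = range (cell A)"
  by (rule faces_eq_cells) (auto dest: arrangementD)

lemma arrangement_chambers: "arrangement A \<Longrightarrow> chambers A = cell A ` (UNIV - \<Union>A)"
  by (rule chambers_eq_cells) (auto dest: arrangementD)

lemma finite_faces:
  assumes A: "arrangement A"
  shows "finite (faces A)"
proof -
  \<comment> \<open>Sign vectors get the value \<open>0\<close> outside \<open>A\<close>, which
    leaves finitely many candidates.\<close>
  let ?V = "PiE_dflt A 0 (\<lambda>_. {-1, 0, 1::real})"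
  have "finite ?V" using arrangementD[OF A] by (intro finite_PiE_dflt) auto
  moreover have "faces A \<subseteq> (\<lambda>s. {y. \<forall>H\<in>A. side H y = s H}) ` ?V"
  proof
    fix F assume "F \<in> faces A"
    then obtain x where F: "F = cell A x" using arrangement_faces[OF A] by auto
    have "(\<lambda>H. if H \<in> A then side H x else 0) \<in> ?V"
      using side_cases by (auto simp: PiE_dflt_def)
    moreover have "F = {y. \<forall>H\<in>A. side H y = (\<lambda>H. if H \<in> A then side H x else 0) H}"
      by (auto simp: F cell_def)
    ultimately show "F \<in> (\<lambda>s. {y. \<forall>H\<in>A. side H y = s H}) ` ?V" by (intro image_eqI)
  qed
  ultimately show ?thesis by (rule finite_surj)
qed

lemma chambers_subset_faces: "arrangement A \<Longrightarrow> chambers A \<subseteq> faces A"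
  by (auto simp: arrangement_faces arrangement_chambers)

text \<open>Meaningful only if \<open>H\<close> belongs to an arrangement of which \<open>F\<close> is a face; otherwise the value
  depends on the chosen point.\<close>

definition face_side :: "(real ^ 'n) set \<Rightarrow> (real ^ 'n) set \<Rightarrow> real" where
  "face_side F H = side H (SOME x. x \<in> F)"

lemma face_side_cell: "H \<in> A \<Longrightarrow> face_side (cell A x) H = side H x"
  unfolding face_side_def using someI[of "\<lambda>y. y \<in> cell A x" x] by (auto simp: cell_def)

lemma face_side_eq_0_iff:
  assumes "arrangement A" "F \<in> faces A" "H \<in> A"
  shows "face_side F H = 0 \<longleftrightarrow> F \<subseteq> H"
proof -
  obtain x where F: "F = cell A x" using assms arrangement_faces[OF assms(1)] by auto
  have "y \<in> H \<longleftrightarrow> x \<in> H" if "y \<in> F" for y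
    using side_eq_imp_mem_iff[OF arrangementD(2)[OF assms(1,3)], of y x] assms(3) that
    by (simp add: F cell_def)
  then have "F \<subseteq> H \<longleftrightarrow> x \<in> H" using F cell_self by blast
  then show ?thesis
    using side_eq_0_iff[OF arrangementD(2)[OF assms(1,3)]] assms(3) F by (simp add: face_side_cell)
qed

text \<open>A nearby point of the segment realizes the composed sign vector. Two candidates for the
  product share the points for small \<open>e\<close>, and cells that meet are equal, so the
  definite description is justified.\<close>

lemma face_prod_cell:
  assumes A: "arrangement A"
  shows "\<exists>z. face_prod A (cell A x) (cell A y) = cell A z \<and>
    (\<forall>H\<in>A. side H z = (if side H x = 0 then side H y else side H x))"
proof -
  let ?s = "\<lambda>H. if side H x = 0 then side H y else side H x"
  note sides = sides_segment[OF A]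
  obtain e0 where e0: "\<forall>H\<in>A. side H (x + e0 *\<^sub>R (y - x)) = ?s H"
    using eventually_happens[OF sides[of x y]] by auto
  define z where "z = x + e0 *\<^sub>R (y - x)"
  have ev: "\<forall>\<^sub>F e in at_right (0::real). x' + e *\<^sub>R (y' - x') \<in> cell A z"
    if "x' \<in> cell A x" "y' \<in> cell A y" for x' y'
    using sides[of x' y'] by eventually_elim (use that e0 in \<open>auto simp: cell_def z_def\<close>)
  have "face_prod A (cell A x) (cell A y) = cell A z"
    unfolding face_prod_def
  proof (rule the_equality)
    show "cell A z \<in> faces A \<and> (\<forall>x\<in>cell A x. \<forall>y\<in>cell A y.
        \<forall>\<^sub>F e in at_right 0. x + e *\<^sub>R (y - x) \<in> cell A z)"
      using ev unfolding arrangement_faces[OF A] by blast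
    fix K assume K: "K \<in> faces A \<and> (\<forall>x\<in>cell A x. \<forall>y\<in>cell A y.
        \<forall>\<^sub>F e in at_right 0. x + e *\<^sub>R (y - x) \<in> K)"
    from K obtain k where k: "K = cell A k" unfolding arrangement_faces[OF A] by blast
    have "\<forall>\<^sub>F e in at_right (0::real). x + e *\<^sub>R (y - x) \<in> K"
      using K cell_self by blast
    from eventually_happens[OF eventually_conj[OF this ev[OF cell_self cell_self]]]
    obtain p where "p \<in> K" "p \<in> cell A z" by (auto simp: trivial_limit_at_right_real)
    then show "K = cell A z" unfolding k by (metis cell_eqI)
  qed
  moreover have "\<forall>H\<in>A. side H z = ?s H"
    using e0 unfolding z_def .
  ultimately show ?thesis by blast
qed

lemma face_prod_in_faces: 
  assumes A: "arrangement A" and F: "F \<in> faces A" and G: "G \<in> faces A"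
  shows "face_prod A F G \<in> faces A"
    and "H \<in> A \<Longrightarrow> face_side (face_prod A F G) H = (if face_side F H = 0 then face_side G H else face_side F H)"
proof -
  obtain x y where xy: "F = cell A x" "G = cell A y" using F G arrangement_faces[OF A] by auto
  obtain z where z: "face_prod A F G = cell A z"
    "\<forall>H\<in>A. side H z = (if side H x = 0 then side H y else side H x)"
    using face_prod_cell[OF A, of x y] unfolding xy by blast
  show "face_prod A F G \<in> faces A"
    unfolding z(1) arrangement_faces[OF A] by simp
  show "face_side (face_prod A F G) H = (if face_side F H = 0 then face_side G H else face_side F H)"
    if "H \<in> A"
    using bspec[OF z(2) that] unfolding z(1) unfolding xy face_side_cell[OF that] .
qed

lemma face_eqI:
  assumes "arrangement A" "F \<in> faces A" "G \<in> faces A" "\<And>H. H \<in> A \<Longrightarrow> face_side F H = face_side G H"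
  shows "F = G"
proof -
  obtain x y where xy: "F = cell A x" "G = cell A y" using assms arrangement_faces[OF assms(1)] by auto
  have "side H x = side H y" if "H \<in> A" for H
    using assms(4)[OF that] unfolding xy face_side_cell[OF that] .
  then show ?thesis unfolding xy cell_eq_iff by blast
qed

text \<open>The composition of signs is written out because \<open>F\<close> is a face of
  \<open>A\<close> and \<open>D\<close> a chamber of \<open>B\<close>, whereas
  \<open>face_prod\<close> multiplies faces of a single arrangement.\<close>

definition face_act :: "(real ^ 'n) set set \<Rightarrow> (real ^ 'n) set \<Rightarrow> (real ^ 'n) set \<Rightarrow> (real ^ 'n) set" where
  "face_act B F D = {x. \<forall>H\<in>B. side H x = (if face_side F H = 0 then face_side D H else face_side F H)}"

lemma face_act_chamber:
  assumes A: "arrangement A" and B: "B \<subseteq> A" and F: "F \<in> faces A" and D: "D \<in> chambers B"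
  shows "face_act B F D \<in> chambers B"
    and "H \<in> B \<Longrightarrow> face_side (face_act B F D) H = (if face_side F H = 0 then face_side D H else face_side F H)"
proof -
  have B': "arrangement B" using arrangement_subset[OF A B] .
  obtain x where x: "F = cell A x" using F arrangement_faces[OF A] by auto
  obtain y where y: "D = cell B y" "y \<notin> \<Union>B" using D arrangement_chambers[OF B'] by auto
  obtain e where e: "\<forall>H\<in>B. side H (x + e *\<^sub>R (y - x)) = (if side H x = 0 then side H y else side H x)"
    using eventually_happens[OF sides_segment[OF B', of x y]] by auto
  define z where "z = x + e *\<^sub>R (y - x)"
  have act: "face_act B F D = cell B z"
    using e B unfolding face_act_def cell_def x y z_def
    by (intro Collect_cong ball_cong) (auto simp: face_side_cell[unfolded cell_def] subset_iff)
  have "z \<notin> H" if "H \<in> B" for H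
    using segment_avoids[OF arrangementD(2)[OF B' that] bspec[OF e that]] that y(2)
    unfolding z_def by blast
  then show "face_act B F D \<in> chambers B"
    using act arrangement_chambers[OF B'] by auto
  show "face_side (face_act B F D) H = (if face_side F H = 0 then face_side D H else face_side F H)" 
    if "H \<in> B" using that B e unfolding act by (auto simp: face_side_cell x y z_def subset_iff)
qed

lemma chamber_eqI:
  assumes "arrangement B" "D \<in> chambers B" "D' \<in> chambers B" "\<And>H. H \<in> B \<Longrightarrow> face_side D H = face_side D' H"
  shows "D = D'"
  using face_eqI[OF assms(1)] chambers_subset_faces[OF assms(1)] assms by blast

lemma face_prod_chamber:
  assumes A: "arrangement A" and F: "F \<in> faces A" and C: "C \<in> chambers A"
  shows "face_prod A F C = face_act A F C"
proof -
  have "C \<in> faces A" using C chambers_subset_faces[OF A] by blast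
  then show ?thesis
    using face_prod_in_faces[OF A F] face_act_chamber[OF A order_refl F C] chambers_subset_faces[OF A]
    by (intro face_eqI[OF A]) auto
qed

lemma chamber_containing_cell:
  assumes A: "arrangement A" and B: "B \<subseteq> A" and C: "C \<in> chambers A"
  shows "chamber_containing B C \<in> chambers B" "C \<subseteq> chamber_containing B C"
    "D \<in> chambers B \<Longrightarrow> C \<subseteq> D \<Longrightarrow> D = chamber_containing B C"
    "H \<in> B \<Longrightarrow> face_side (chamber_containing B C) H = face_side C H"
proof -
  have B': "arrangement B" using arrangement_subset[OF A B] .
  obtain x where x: "C = cell A x" "x \<notin> \<Union>A" using C arrangement_chambers[OF A] by auto
  have 1: "cell B x \<in> chambers B" using x B arrangement_chambers[OF B'] by auto
  have 2: "C \<subseteq> cell B x" using x B by (auto simp: cell_def)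
  have 3: "D = cell B x" if D: "D \<in> chambers B" "C \<subseteq> D" for D
  proof -
    obtain y where y: "D = cell B y" using D(1) arrangement_chambers[OF B'] by auto
    have "x \<in> D" using D(2) x(1) cell_self by blast
    then show ?thesis using cell_eqI unfolding y by blast
  qed
  have 4: "chamber_containing B C = cell B x"
    unfolding chamber_containing_def by (rule the_equality, intro conjI 1 2) (elim conjE, rule 3)
  show "chamber_containing B C \<in> chambers B" "C \<subseteq> chamber_containing B C"
    unfolding 4 by (rule 1, rule 2)
  show "D = chamber_containing B C" if "D \<in> chambers B" "C \<subseteq> D"
    unfolding 4 using that by (rule 3)
  show "face_side (chamber_containing B C) H = face_side C H" if "H \<in> B"
    using that B unfolding 4 unfolding x(1) by (simp add: face_side_cell subset_iff)
qed

text \<open>A point off the earlier hyperplanes, moved slightly towards a point off the new one,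
  leaves the new one and stays off the others.\<close>

lemma avoid_hyperplanes:
  assumes "arrangement A"
  shows "\<exists>x. x \<notin> \<Union>A"
  using arrangementD(1)[OF assms] assms
proof (induction A rule: finite_induct)
  case (insert H A)
  then obtain z where z: "z \<notin> \<Union>A" using arrangement_subset[OF insert.prems subset_insertI] by auto
  note hyp = arrangementD(2)[OF insert.prems]
  obtain a b where ab: "a \<noteq> 0" "H = {x. inner a x = b}"
    using hyp_fun_obtain[OF hyp[OF insertI1]] .
  obtain p where p: "p \<notin> H"
  proof (cases "b = 0")
    case True
    then show thesis using that[of a] ab by simp
  next
    case False
    then show thesis using that[of 0] ab by simp
  qed
  obtain e where e: "\<forall>K\<in>insert H A. side K (z + e *\<^sub>R (p - z)) = (if side K z = 0 then side K p else side K z)"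
    using eventually_happens[OF sides_segment[OF insert.prems, of z p]] by auto
  have "z + e *\<^sub>R (p - z) \<notin> K" if K: "K \<in> insert H A" for K
    using segment_avoids[OF hyp[OF K] bspec[OF e K]] z p K by blast
  then show ?case by blast
qed simp

lemma chambers_nonempty: "arrangement A \<Longrightarrow> chambers A \<noteq> {}"
  using avoid_hyperplanes[of A] arrangement_chambers[of A] by auto

text \<open>The cell in \<open>A\<close> of a point of \<open>D\<close> may lie on hyperplanes
  outside \<open>B\<close>. Multiplying it by any chamber of \<open>A\<close> pushes it off these
  and keeps its sides for \<open>B\<close>.\<close>

lemma chamber_containing_surj:
  assumes A: "arrangement A" and B: "B \<subseteq> A" and D: "D \<in> chambers B"
  shows "\<exists>C\<in>chambers A. chamber_containing B C = D"
proof -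
  obtain C where C: "C \<in> chambers A" using chambers_nonempty[OF A] by blast
  have B': "arrangement B" using arrangement_subset[OF A B] .
  obtain x where x: "D = cell B x" "x \<notin> \<Union>B" using D arrangement_chambers[OF B'] by auto
  have Fx: "cell A x \<in> faces A" using arrangement_faces[OF A] by auto
  define C' where "C' = face_act A (cell A x) C"
  have C': "C' \<in> chambers A" unfolding C'_def by (rule face_act_chamber[OF A order_refl Fx C])
  have "chamber_containing B C' = D"
  proof (rule chamber_eqI[OF B' _ D])
    show "chamber_containing B C' \<in> chambers B" by (rule chamber_containing_cell[OF A B C'])
    fix H assume H: "H \<in> B"
    then have "side H x \<noteq> 0" using x side_eq_0_iff[OF arrangementD(2)[OF B' H]] by blast
    moreover have "H \<in> A" using H B by blast
    ultimately show "face_side (chamber_containing B C') H = face_side D H"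
      using face_act_chamber(2)[OF A order_refl Fx C, of H]
      unfolding chamber_containing_cell(4)[OF A B C' H] x face_side_cell[OF H]
      by (simp add: face_side_cell C'_def)
  qed
  with C' show ?thesis by blast
qed

section \<open>Counting chambers by the Moebius function\<close>

lemma affine_hyperplane_set: "is_hyperplane H \<Longrightarrow> affine H"
  by (auto simp: is_hyperplane_def intro: affine_hyperplane)

lemma is_hyperplane_neq_UNIV: "is_hyperplane H \<Longrightarrow> H \<noteq> UNIV"
  using avoid_hyperplanes[of "{H}"] by (auto simp: arrangement_def)

text \<open>Writing codimension signs as products of two such signs lets a hyperplane section flip
  just one factor. The value at the empty set, where \<open>nat\<close> sends -1 to 0, never enters
  a nonzero term.\<close>

definition dim_sign :: "(real ^ 'n) set \<Rightarrow> int" where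
  "dim_sign W = (- 1) ^ nat (aff_dim W)"

lemma dim_sign_square [simp]: "dim_sign W * dim_sign W = 1"
  by (simp add: dim_sign_def flip: power_add)

lemma dim_sign_hyperplane_section:
  assumes V: "affine V" and H: "is_hyperplane H" and ne: "V \<inter> H \<noteq> {}" and sub: "\<not> V \<subseteq> H"
  shows "dim_sign (V \<inter> H) = - dim_sign V"
proof -
  obtain a b where ab: "H = {x. inner a x = b}" using hyp_fun_obtain[OF H] .
  have "aff_dim (V \<inter> H) = aff_dim V - 1"
    using aff_dim_affine_Int_hyperplane[OF V, of a b] ne sub unfolding ab by simp
  moreover have "aff_dim (V \<inter> H) \<ge> 0" using ne aff_dim_negative_iff[of "V \<inter> H"] by linarith
  ultimately have "nat (aff_dim V) = Suc (nat (aff_dim (V \<inter> H)))" by linarith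
  then show ?thesis by (simp add: dim_sign_def)
qed

section \<open>Deletion and restriction for counts of regions\<close>

lemma sum_Pow_insert:
  assumes "finite B" "H \<notin> B"
  shows "(\<Sum>S\<in>Pow (insert H B). f S) = (\<Sum>S\<in>Pow B. f S + f (insert H S) :: 'b :: comm_monoid_add)"
proof -
  have "inj_on (insert H) (Pow B)" using assms(2) by (auto simp: inj_on_def)
  moreover have "Pow B \<inter> insert H ` Pow B = {}" using assms(2) by auto
  ultimately show ?thesis
    unfolding Pow_insert using assms(1)
    by (subst sum.union_disjoint) (auto simp: sum.reindex sum.distrib)
qed

text \<open>For affine \<open>V\<close> these stand for the chambers induced on \<open>V\<close>,
  since each of them meets \<open>V\<close> in a convex set. Keeping the cells of \<open>B\<close>
  whole makes the families for \<open>V\<close> and \<open>V \<inter> H\<close> comparable.\<close>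

definition regions :: "(real ^ 'n) set \<Rightarrow> (real ^ 'n) set set \<Rightarrow> (real ^ 'n) set set" where
  "regions V B = cell B ` (V - \<Union>B)"

lemma finite_regions: "arrangement B \<Longrightarrow> finite (regions V B)"
  unfolding regions_def
  by (rule finite_subset[OF _ finite_faces]) (auto simp: arrangement_faces)

text \<open>A short step from \<open>x\<close> towards \<open>y\<close> stays in the flat
  \<open>V\<close> and, \<open>x\<close> being off \<open>B\<close>, in the same cell of
  \<open>B\<close>; with respect to \<open>H\<close> it takes the side of \<open>y\<close>.\<close>

lemma regions_push:
  assumes A: "arrangement (insert H B)" and V: "affine V"
    and x: "x \<in> V" "x \<in> H" "x \<notin> \<Union>B" and y: "y \<in> V" "side H y = s"
  shows "\<exists>z\<in>V - \<Union>B. side H z = s \<and> cell B z = cell B x"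
proof -
  note hyp = arrangementD(2)[OF A]
  obtain e where e: "\<forall>K\<in>insert H B. side K (x + e *\<^sub>R (y - x)) = (if side K x = 0 then side K y else side K x)"
    using eventually_happens[OF sides_segment[OF A, of x y]] by auto
  define z where "z = x + e *\<^sub>R (y - x)"
  have "z = (1 - e) *\<^sub>R x + e *\<^sub>R y" by (simp add: z_def algebra_simps)
  with V x y have zV: "z \<in> V" by (simp add: affine_alt)
  have sB: "side K z = side K x \<and> z \<notin> K" if K: "K \<in> B" for K
  proof -
    have "x \<notin> K" using K x by blast
    moreover have "side K z = (if side K x = 0 then side K y else side K x)"
      using e K by (simp add: z_def)
    ultimately show ?thesis
      using side_eq_0_iff[OF hyp, of K x] side_eq_0_iff[OF hyp, of K z] K by simp
  qed
  have "side H z = s"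
    using e y(2) x(2) side_eq_0_iff[OF hyp, of H x] by (simp add: z_def)
  then show ?thesis using zV sB by (intro bexI[of _ z]) (auto simp: cell_eq_iff)
qed

text \<open>The regions of \<open>B\<close> that reach the positive side of \<open>H\<close> within
  \<open>V\<close> and those that reach the negative side together are all regions; those in both
  families are the ones cut by \<open>H\<close>. Inclusion and exclusion gives the count.\<close>

lemma card_regions_insert:
  assumes A: "arrangement (insert H B)" and HB: "H \<notin> B" and V: "affine V" and VH: "\<not> V \<subseteq> H"
  shows "card (regions V (insert H B)) = card (regions V B) + card (regions (V \<inter> H) B)"
proof -
  note hyp = arrangementD(2)[OF A]
  have HH: "is_hyperplane H" by (rule hyp) simp
  have B: "arrangement B" using arrangement_subset[OF A] by blast
  define P where "P s = cell B ` {x \<in> V - \<Union>B. side H x = s}" for s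
  define f where "f s c = c \<inter> {x. side H x = s}" for s c
  have cell_f: "cell (insert H B) x = f (side H x) (cell B x)" for x
    by (auto simp: cell_def f_def)
  have fin: "finite (P s)" for s
    by (rule finite_subset[OF _ finite_regions[OF B, of V]]) (auto simp: P_def regions_def)
  have img: "cell (insert H B) ` {x \<in> V - \<Union>B. side H x = s} = f s ` P s" for s
    unfolding P_def image_image by (intro image_cong refl) (simp add: cell_f)
  have "V - \<Union>(insert H B) = {x \<in> V - \<Union>B. side H x = 1} \<union> {x \<in> V - \<Union>B. side H x = - 1}"
  proof -
    have "x \<notin> H \<longleftrightarrow> side H x = 1 \<or> side H x = - 1" for x
      using side_cases[of H x] side_eq_0_iff[OF HH, of x] by auto
    then show ?thesis by blast
  qed
  then have "regions V (insert H B) = f 1 ` P 1 \<union> f (- 1) ` P (- 1)"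
    unfolding regions_def by (simp only: image_Un img)
  moreover have inj: "inj_on (f s) (P s)" for s
  proof (rule inj_onI)
    fix c c' assume c: "c \<in> P s" and c': "c' \<in> P s" and eq: "f s c = f s c'"
    obtain x where x: "c = cell B x" "side H x = s" using c unfolding P_def by blast
    obtain x' where x': "c' = cell B x'" using c' unfolding P_def by blast
    have "x \<in> f s c" using x by (simp add: f_def)
    then have "x \<in> c'" unfolding eq by (simp add: f_def)
    then show "c = c'" using cell_eqI unfolding x x' by blast
  qed
  moreover have "f 1 ` P 1 \<inter> f (- 1) ` P (- 1) = {}"
  proof -
    have False if c1: "c \<in> f 1 ` P 1" and c2: "c \<in> f (- 1) ` P (- 1)" for c
    proof -
      have "\<exists>x\<in>c. side H x = 1" using c1 by (auto simp: P_def f_def)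
      then obtain x where "x \<in> c" "side H x = 1" ..
      moreover have "side H x = - 1" if "x \<in> c" for x using c2 that by (auto simp: f_def)
      ultimately show False by force
    qed
    then show ?thesis by blast
  qed
  ultimately have "card (regions V (insert H B)) = card (P 1) + card (P (- 1))"
    using fin by (simp add: card_Un_disjoint card_image)
  also have "\<dots> = card (P 1 \<union> P (- 1)) + card (P 1 \<inter> P (- 1))"
    by (rule card_Un_Int) (rule fin)+
  also have "P 1 \<union> P (- 1) = regions V B"
  proof
    show "P 1 \<union> P (- 1) \<subseteq> regions V B" by (auto simp: P_def regions_def)
    show "regions V B \<subseteq> P 1 \<union> P (- 1)"
    proof
      fix c assume "c \<in> regions V B"
      then obtain x where x: "x \<in> V" "x \<notin> \<Union>B" "c = cell B x" by (auto simp: regions_def)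
      obtain y where y: "y \<in> V" "y \<notin> H" using VH by blast
      \<comment> \<open>A representative on \<open>H\<close> is pushed towards a point of
        \<open>V\<close> outside \<open>H\<close>.\<close>
      have "\<exists>z\<in>V - \<Union>B. side H z \<noteq> 0 \<and> cell B z = cell B x"
      proof (cases "x \<in> H")
        case True
        have "side H y \<noteq> 0" using side_eq_0_iff[OF HH, of y] y(2) by simp
        with regions_push[OF A V x(1) True x(2) y(1) refl] show ?thesis by metis
      next
        case False
        then have "side H x \<noteq> 0" using side_eq_0_iff[OF HH, of x] by simp
        with x show ?thesis by blast
      qed
      then obtain z where z: "z \<in> V - \<Union>B" "side H z \<noteq> 0" "cell B z = c" using x(3) by auto
      from side_cases[of H z] z(2) have "side H z = 1 \<or> side H z = - 1" by simp
      then show "c \<in> P 1 \<union> P (- 1)" using z(1) unfolding P_def z(3)[symmetric] by blast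
    qed
  qed
  also have "P 1 \<inter> P (- 1) = regions (V \<inter> H) B"
  proof
    show "P 1 \<inter> P (- 1) \<subseteq> regions (V \<inter> H) B"
    proof
      fix c assume c: "c \<in> P 1 \<inter> P (- 1)"
      obtain x where x: "c = cell B x" "x \<in> V" "x \<notin> \<Union>B" "side H x = 1" using c unfolding P_def by blast
      obtain y where y: "c = cell B y" "y \<in> V" "side H y = - 1" using c unfolding P_def by blast
      \<comment> \<open>The segment between representatives on the two sides crosses
        \<open>H\<close>, and convexity keeps it in the cell and in \<open>V\<close>.\<close>
      have "closed_segment x y \<inter> H \<noteq> {}"
      proof
        assume "closed_segment x y \<inter> H = {}"
        from connected_side_const[OF HH connected_segment(1) this ends_in_segment]
        show False using x y by simp
      qed
      then obtain z where z: "z \<in> closed_segment x y" "z \<in> H" by blast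
      have "closed_segment x y \<subseteq> c"
        using convex_cell[of B x] hyp cell_self[of x B] cell_self[of y B] unfolding x(1)[symmetric] y(1)[symmetric]
        by (intro closed_segment_subset) auto
      then have zc: "cell B z = c" using z(1) x(1) cell_eqI by blast
      have zV: "z \<in> V" using closed_segment_subset[OF x(2) y(2) affine_imp_convex[OF V]] z(1) by blast
      have "z \<notin> K" if K: "K \<in> B" for K
      proof -
        have "side K z = side K x" using zc x(1) K by (auto simp: cell_eq_iff)
        then show ?thesis using side_eq_imp_mem_iff[OF hyp, of K z x] x(3) K by blast
      qed
      then show "c \<in> regions (V \<inter> H) B" using z(2) zV zc unfolding regions_def by blast
    qed
    show "regions (V \<inter> H) B \<subseteq> P 1 \<inter> P (- 1)"
    proof
      fix c assume "c \<in> regions (V \<inter> H) B"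
      then obtain x where x: "x \<in> V" "x \<in> H" "x \<notin> \<Union>B" "c = cell B x" by (auto simp: regions_def)
      obtain y where y: "y \<in> V" "y \<notin> H" using VH by blast
      \<comment> \<open>The reflection of \<open>y\<close> in the point \<open>x\<close> of
        \<open>H\<close> is a point of \<open>V\<close> on the opposite side.\<close>
      define y' where "y' = x + (- 1) *\<^sub>R (y - x)"
      have "y' = (1 - (- 1)) *\<^sub>R x + (- 1) *\<^sub>R y" by (simp add: y'_def algebra_simps scaleR_2)
      then have y'V: "y' \<in> V" using V x(1) y(1) unfolding affine_alt by metis
      have "hyp_fun H x = 0" using side_eq_0_iff[OF HH, of x] x(2) by (simp add: side_def sgn_0_0)
      then have sy': "side H y' = - side H y"
        unfolding side_def y'_def hyp_fun_segment[OF HH] by (simp add: sgn_minus)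
      have sy: "side H y = 1 \<or> side H y = - 1"
        using side_cases[of H y] side_eq_0_iff[OF HH, of y] y(2) by blast
      have "c \<in> P s" if u: "u \<in> V" "side H u = s" for u s
      proof -
        from regions_push[OF A V x(1-3) u] obtain z where "z \<in> V - \<Union>B" "side H z = s" "cell B z = cell B x"
          by blast
        then show ?thesis unfolding P_def x(4) by (intro image_eqI[of _ _ z]) auto
      qed
      from this[OF y(1) refl] this[OF y'V refl] sy sy' show "c \<in> P 1 \<inter> P (- 1)" by auto
    qed
  qed
  finally show ?thesis .
qed

text \<open>Deletion and restriction in one step: since subsets of \<open>B\<close>, and not their traces on \<open>V\<close>,
  index the sum, hyperplanes with the same trace on \<open>V\<close> need no separate treatment.\<close>

lemma card_regions_eq_sum:
  assumes "arrangement B" "affine V"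
  shows "int (card (regions V B)) =
    (\<Sum>S\<in>Pow B. if V \<inter> \<Inter>S = {} then 0 else (- 1) ^ card S * (dim_sign V * dim_sign (V \<inter> \<Inter>S)))"
  using arrangementD(1)[OF assms(1)] assms
proof (induction B arbitrary: V rule: finite_induct)
  case empty
  have "regions V {} = (if V = {} then {} else {UNIV})" by (auto simp: regions_def cell_def)
  then show ?case by simp
next
  case (insert H B)
  let ?t = "\<lambda>V S. if V \<inter> \<Inter>S = {} then 0 else (- 1) ^ card S * (dim_sign V * dim_sign (V \<inter> \<Inter>S))"
  have A: "arrangement (insert H B)" and V: "affine V" by fact+
  have B: "arrangement B" using arrangement_subset[OF A] by blast
  have HH: "is_hyperplane H" using arrangementD(2)[OF A] by blast
  have cd: "card (insert H S) = Suc (card S)" if "S \<in> Pow B" for S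
    using that insert.hyps by (intro card_insert_disjoint) (auto intro: finite_subset)
  show ?case
  proof (cases "V \<subseteq> H")
    case True
    \<comment> \<open>Intersecting with \<open>H\<close> does not change \<open>V\<close>, so adding
      \<open>H\<close> to \<open>S\<close> only flips the sign.\<close>
    have "?t V S + ?t V (insert H S) = 0" if "S \<in> Pow B" for S
    proof -
      have "V \<inter> \<Inter>(insert H S) = V \<inter> \<Inter>S" using True by blast
      then show ?thesis using cd[OF that] by simp
    qed
    moreover have "regions V (insert H B) = {}" using True by (auto simp: regions_def)
    ultimately show ?thesis by (simp add: sum_Pow_insert[OF insert.hyps(1,2)])
  next
    case False
    have VH: "affine (V \<inter> H)" using V affine_hyperplane_set[OF HH] by (rule affine_Int)
    \<comment> \<open>The sign from the larger subset is absorbed by the change from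
      \<open>dim_sign V\<close> to \<open>dim_sign (V \<inter> H)\<close>.\<close>
    have "?t V (insert H S) = ?t (V \<inter> H) S" if "S \<in> Pow B" for S
    proof (cases "V \<inter> H \<inter> \<Inter>S = {}")
      case True
      then show ?thesis by (simp add: Int_assoc)
    next
      case ne: False
      then have "dim_sign (V \<inter> H) = - dim_sign V"
        by (intro dim_sign_hyperplane_section V HH False) blast
      then show ?thesis using ne cd[OF that] by (simp add: Int_assoc)
    qed
    then have "(\<Sum>S\<in>Pow (insert H B). ?t V S) = (\<Sum>S\<in>Pow B. ?t V S) + (\<Sum>S\<in>Pow B. ?t (V \<inter> H) S)"
      by (subst sum_Pow_insert[OF insert.hyps(1,2)]) (simp only: sum.distrib cong: sum.cong)
    also have "\<dots> = int (card (regions V B)) + int (card (regions (V \<inter> H) B))"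
      using insert.IH[OF B V] insert.IH[OF B VH] by simp
    also have "\<dots> = int (card (regions V (insert H B)))"
      using card_regions_insert[OF A insert.hyps(2) V False] by simp
    finally show ?thesis by simp
  qed
qed

text \<open>For \<open>V = UNIV\<close> and a flat \<open>W\<close> this is Whitney's expression for
  \<mu>(UNIV, W). The parameter \<open>V\<close> makes room for inductions that restrict to
  \<open>V \<inter> H\<close>.\<close>

definition whitney_sum :: "(real ^ 'n) set \<Rightarrow> (real ^ 'n) set set \<Rightarrow> (real ^ 'n) set \<Rightarrow> int" where
  "whitney_sum V B W = (\<Sum>S\<in>Pow B. if V \<inter> \<Inter>S = W then (- 1) ^ card S else 0)"

text \<open>Splitting subsets by membership of \<open>H\<close> gives the difference of the sums for
  \<open>V\<close> and \<open>V \<inter> H\<close>. For a proper nonempty section the dimension sign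
  flips, so the signed terms add up; otherwise the difference or its second term is zero.\<close>

lemma whitney_sum_sign:
  assumes "arrangement B" "affine V" "W \<noteq> {}"
  shows "dim_sign V * dim_sign W * whitney_sum V B W \<ge> 0"
  using arrangementD(1)[OF assms(1)] assms
proof (induction B arbitrary: V rule: finite_induct)
  case empty
  have "whitney_sum V {} W = (if V = W then 1 else 0)"
    unfolding whitney_sum_def Pow_empty by simp
  then show ?case by simp
next
  case (insert H B)
  have A: "arrangement (insert H B)" and V: "affine V" and W: "W \<noteq> {}" by fact+
  have B: "arrangement B" using arrangement_subset[OF A] by blast
  have HH: "is_hyperplane H" using arrangementD(2)[OF A] by blast
  have VH: "affine (V \<inter> H)" using V affine_hyperplane_set[OF HH] by (rule affine_Int)
  have cd: "card (insert H S) = Suc (card S)" if "S \<in> Pow B" for S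
    using that insert.hyps by (intro card_insert_disjoint) (auto intro: finite_subset)
  have "whitney_sum V (insert H B) W = (\<Sum>S\<in>Pow B. (if V \<inter> \<Inter>S = W then (- 1) ^ card S else 0) -
      (if V \<inter> H \<inter> \<Inter>S = W then (- 1) ^ card S else 0))"
    unfolding whitney_sum_def sum_Pow_insert[OF insert.hyps(1,2)]
    by (intro sum.cong refl) (simp add: cd Int_assoc)
  then have rec: "whitney_sum V (insert H B) W = whitney_sum V B W - whitney_sum (V \<inter> H) B W"
    unfolding whitney_sum_def by (simp add: sum_subtractf)
  consider "V \<subseteq> H" | "V \<inter> H = {}" | "V \<inter> H \<noteq> {}" "\<not> V \<subseteq> H" by blast
  then show ?case
  proof cases
    case 1
    then have "V \<inter> H = V" by blast
    then show ?thesis by (simp add: rec)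
  next
    case 2
    then have "whitney_sum (V \<inter> H) B W = 0" using W by (simp add: whitney_sum_def)
    then show ?thesis using insert.IH[OF B V W] by (simp add: rec)
  next
    case 3
    then show ?thesis
      using insert.IH[OF B V W] insert.IH[OF B VH W] dim_sign_hyperplane_section[OF V HH]
      by (simp add: rec algebra_simps)
  qed
qed

section \<open>Whitney's formula for the Moebius function and Zaslavsky's theorem\<close>

lemma sum_Pow_alternating:
  assumes "finite T" "T \<noteq> {}"
  shows "(\<Sum>S\<in>Pow T. (- 1) ^ card S) = (0 :: int)"
proof -
  obtain H where H: "H \<in> T" using assms(2) by blast
  have "(\<Sum>S\<in>Pow (insert H (T - {H})). (- 1) ^ card S) =
      (\<Sum>S\<in>Pow (T - {H}). (- 1) ^ card S + (- 1) ^ card (insert H S) :: int)"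
    using assms(1) by (intro sum_Pow_insert) auto
  also have "\<dots> = 0"
  proof (rule sum.neutral, rule ballI)
    fix S assume "S \<in> Pow (T - {H})"
    then have "card (insert H S) = Suc (card S)"
      using assms(1) by (intro card_insert_disjoint) (auto intro: finite_subset)
    then show "(- 1) ^ card S + (- 1) ^ card (insert H S) = (0 :: int)" by simp
  qed
  finally show ?thesis using H by (simp add: insert_absorb)
qed

lemma finite_intersection_poset: "arrangement B \<Longrightarrow> finite (intersection_poset B)"
  unfolding intersection_poset_def
  by (rule finite_subset[of _ "Inter ` Pow B"]) (auto dest: arrangementD)

lemma UNIV_in_intersection_poset: "UNIV \<in> intersection_poset B"
  unfolding intersection_poset_def by (intro CollectI exI[of _ "{}"]) auto

text \<open>Both sides satisfy the same recursion: summed over the flats containing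
  \<open>W\<close>, the Whitney sums regroup into the alternating sum over all subsets of the
  hyperplanes containing \<open>W\<close>, which vanishes unless \<open>W\<close> is the whole
  space.\<close>

lemma moebius_eq_whitney_sum:
  assumes A: "arrangement B" and W: "W \<in> intersection_poset B"
  shows "poset_moebius (intersection_poset B) UNIV W = whitney_sum UNIV B W"
  using W
proof (induction "card {Z \<in> intersection_poset B. W \<subset> Z}" arbitrary: W rule: less_induct)
  case less
  let ?L = "intersection_poset B"
  note fin = finite_intersection_poset[OF A] and finB = arrangementD(1)[OF A]
  show ?case
  proof (cases "W = UNIV")
    case True
    \<comment> \<open>Hyperplanes are proper, so only the empty subset contributes.\<close>
    have "UNIV \<inter> \<Inter>S = UNIV \<longleftrightarrow> S = {}" if "S \<in> Pow B" for S
      using is_hyperplane_neq_UNIV[OF arrangementD(2)[OF A]] that by auto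
    then have "whitney_sum UNIV B UNIV = (\<Sum>S\<in>Pow B. if S = {} then 1 else 0)"
      unfolding whitney_sum_def by (intro sum.cong) auto
    also have "\<dots> = 1" using finB by simp
    finally have "whitney_sum UNIV B UNIV = 1" .
    then show ?thesis
      using True less.prems fin by (simp add: poset_moebius.simps)
  next
    case False
    have Wne: "W \<noteq> {}" using less.prems by (auto simp: intersection_poset_def)
    have IH: "poset_moebius ?L UNIV Z = whitney_sum UNIV B Z" if "Z \<in> ?L" "W \<subset> Z" for Z
      using that less.prems fin by (intro less.hyps psubset_card_mono) auto
    define T where "T = {H \<in> B. W \<subseteq> H}"
    have T: "finite T" using finB by (simp add: T_def)
    have "T \<noteq> {}" using less.prems False by (auto simp: T_def intersection_poset_def)
    have "(\<Sum>Z\<in>{Z \<in> ?L. W \<subseteq> Z}. whitney_sum UNIV B Z) =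
        (\<Sum>Z\<in>{Z \<in> ?L. W \<subseteq> Z}. \<Sum>S\<in>{S \<in> Pow T. \<Inter>S = Z}. (- 1) ^ card S)"
    proof (rule sum.cong)
      fix Z assume Z: "Z \<in> {Z \<in> ?L. W \<subseteq> Z}"
      show "whitney_sum UNIV B Z = (\<Sum>S\<in>{S \<in> Pow T. \<Inter>S = Z}. (- 1) ^ card S)"
        unfolding whitney_sum_def
        by (rule sum.mono_neutral_cong_right) (use finB Z in \<open>auto simp: T_def\<close>)
    qed simp
    also have "\<dots> = (\<Sum>S\<in>Pow T. (- 1) ^ card S)"
    proof (rule sum.group)
      show "Inter ` Pow T \<subseteq> {Z \<in> ?L. W \<subseteq> Z}"
      proof clarify
        fix S assume S: "S \<subseteq> T"
        then have WS: "W \<subseteq> \<Inter>S" by (auto simp: T_def)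
        moreover have "S \<subseteq> B" using S by (auto simp: T_def)
        ultimately show "\<Inter>S \<in> ?L \<and> W \<subseteq> \<Inter>S"
          unfolding intersection_poset_def using Wne by blast
      qed
    qed (use T fin in auto)
    also have "\<dots> = 0" using T \<open>T \<noteq> {}\<close> by (rule sum_Pow_alternating)
    also have "{Z \<in> ?L. W \<subseteq> Z} = insert W {Z \<in> ?L. W \<subset> Z}" using less.prems by blast
    finally have "(\<Sum>Z\<in>insert W {Z \<in> ?L. W \<subset> Z}. whitney_sum UNIV B Z) = 0" .
    then have "whitney_sum UNIV B W = - (\<Sum>Z\<in>{Z \<in> ?L. W \<subset> Z}. whitney_sum UNIV B Z)"
      using fin by simp
    also have "\<dots> = - (\<Sum>Z\<in>{Z \<in> ?L. W \<subset> Z}. poset_moebius ?L UNIV Z)" using IH by simp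
    also have "\<dots> = poset_moebius ?L UNIV W"
      using False less.prems fin UNIV_in_intersection_poset[of B] by (subst (2) poset_moebius.simps) simp
    finally show ?thesis by simp
  qed
qed

lemma codim_sign:
  fixes W :: "(real ^ 'n) set"
  assumes "W \<noteq> {}"
  shows "(- 1) ^ codim W = dim_sign (UNIV :: (real ^ 'n) set) * dim_sign W"
proof -
  from assms have "aff_dim W \<ge> 0" using aff_dim_negative_iff[of W] by linarith
  moreover have "aff_dim W \<le> aff_dim (UNIV :: (real ^ 'n) set)" by (intro aff_dim_subset) simp
  ultimately have "nat (aff_dim (UNIV :: (real ^ 'n) set)) = codim W + nat (aff_dim W)"
    unfolding codim_def by linarith
  then have "dim_sign (UNIV :: (real ^ 'n) set) = (- 1) ^ codim W * dim_sign W"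
    unfolding dim_sign_def by (simp only: power_add)
  then show ?thesis by (simp only: mult.assoc dim_sign_square mult_1_right)
qed

lemma moebius_sign:
  assumes A: "arrangement B" and W: "W \<in> intersection_poset B"
  shows "\<bar>poset_moebius (intersection_poset B) UNIV W\<bar> = (- 1) ^ codim W * poset_moebius (intersection_poset B) UNIV W"
proof -
  let ?m = "poset_moebius (intersection_poset B) UNIV W"
  have ne: "W \<noteq> {}" using W by (auto simp: intersection_poset_def)
  have "(- 1) ^ codim W * ?m \<ge> 0"
    using whitney_sum_sign[OF A affine_UNIV ne] unfolding codim_sign[OF ne] moebius_eq_whitney_sum[OF A W] .
  moreover have "\<bar>(- 1) ^ codim W * ?m\<bar> = \<bar>?m\<bar>" by (simp add: abs_mult)
  ultimately show ?thesis by linarith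
qed

text \<open>In the signed sum over subsets for \<open>V = UNIV\<close>, the subsets with
  intersection \<open>W\<close> contribute \<open>(- 1) ^ codim W\<close> times the Whitney sum,
  which is the absolute Moebius value.\<close>

lemma card_chambers_eq_sum_moebius:
  fixes B :: "(real ^ 'n) set set"
  assumes A: "arrangement B"
  shows "int (card (chambers B)) = (\<Sum>W\<in>intersection_poset B. \<bar>poset_moebius (intersection_poset B) UNIV W\<bar>)"
proof -
  let ?L = "intersection_poset B"
  let ?u = "dim_sign (UNIV :: (real ^ 'n) set)"
  note fin = finite_intersection_poset[OF A] and finB = arrangementD(1)[OF A]
  have "int (card (chambers B)) = int (card (regions UNIV B))"
    by (simp add: arrangement_chambers[OF A] regions_def)
  also have "\<dots> = (\<Sum>S\<in>{S \<in> Pow B. \<Inter>S \<noteq> {}}. (- 1) ^ card S * (?u * dim_sign (\<Inter>S)))"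
    unfolding card_regions_eq_sum[OF A affine_UNIV]
    by (rule sum.mono_neutral_cong_right) (use finB in auto)
  also have "\<dots> = (\<Sum>W\<in>?L. \<Sum>S\<in>{S \<in> {S \<in> Pow B. \<Inter>S \<noteq> {}}. \<Inter>S = W}. (- 1) ^ card S * (?u * dim_sign (\<Inter>S)))"
    by (rule sum.group[symmetric]) (use finB fin in \<open>auto simp: intersection_poset_def\<close>)
  also have "\<dots> = (\<Sum>W\<in>?L. \<bar>poset_moebius ?L UNIV W\<bar>)"
  proof (rule sum.cong)
    fix W assume W: "W \<in> ?L"
    have ne: "W \<noteq> {}" using W by (auto simp: intersection_poset_def)
    have "(\<Sum>S\<in>{S \<in> {S \<in> Pow B. \<Inter>S \<noteq> {}}. \<Inter>S = W}. (- 1) ^ card S * (?u * dim_sign (\<Inter>S))) =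
        (\<Sum>S\<in>Pow B. if \<Inter>S = W then (- 1) ^ card S * (?u * dim_sign W) else 0)"
      by (rule sum.mono_neutral_cong_left) (use finB ne in auto)
    also have "\<dots> = (- 1) ^ codim W * whitney_sum UNIV B W"
      unfolding codim_sign[OF ne] whitney_sum_def sum_distrib_left by (intro sum.cong) auto
    finally show "(\<Sum>S\<in>{S \<in> {S \<in> Pow B. \<Inter>S \<noteq> {}}. \<Inter>S = W}. (- 1) ^ card S * (?u * dim_sign (\<Inter>S))) =
      \<bar>poset_moebius ?L UNIV W\<bar>"
      using moebius_sign[OF A W] unfolding moebius_eq_whitney_sum[OF A W] by simp
  qed simp
  finally show ?thesis .
qed

text \<open>The flats of the localization are the flats of \<open>B\<close> that contain all of
  \<open>gs\<close>. A subset of \<open>B\<close> with such an intersection consists of localized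
  hyperplanes, so Whitney sums, and with them Moebius values, agree.\<close>

lemma card_chambers_localization:
  assumes A: "arrangement B"
  shows "int (card (chambers {H \<in> B. \<forall>G\<in>gs. G \<subseteq> H})) =
    (\<Sum>W\<in>{W \<in> intersection_poset B. \<forall>G\<in>gs. G \<subseteq> W}. \<bar>poset_moebius (intersection_poset B) UNIV W\<bar>)"
proof -
  define C where "C = {H \<in> B. \<forall>G\<in>gs. G \<subseteq> H}"
  have CB: "C \<subseteq> B" by (auto simp: C_def)
  have C: "arrangement C" using arrangement_subset[OF A CB] .
  have L: "intersection_poset C = {W \<in> intersection_poset B. \<forall>G\<in>gs. G \<subseteq> W}"
  proof
    show "intersection_poset C \<subseteq> {W \<in> intersection_poset B. \<forall>G\<in>gs. G \<subseteq> W}"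
      by (auto simp: intersection_poset_def C_def)
    show "{W \<in> intersection_poset B. \<forall>G\<in>gs. G \<subseteq> W} \<subseteq> intersection_poset C"
    proof clarify
      fix W assume "W \<in> intersection_poset B" and gs: "\<forall>G\<in>gs. G \<subseteq> W"
      then obtain S where S: "W = \<Inter>S" "S \<subseteq> B" "\<Inter>S \<noteq> {}" unfolding intersection_poset_def by blast
      have "S \<subseteq> C" using S(1,2) gs unfolding C_def by blast
      then show "W \<in> intersection_poset C" unfolding intersection_poset_def using S by blast
    qed
  qed
  have "whitney_sum UNIV C W = whitney_sum UNIV B W" if W: "W \<in> intersection_poset C" for W
    unfolding whitney_sum_def
  proof (rule sum.mono_neutral_left)
    show "\<forall>S\<in>Pow B - Pow C. (if UNIV \<inter> \<Inter>S = W then (- 1) ^ card S else 0) = (0 :: int)"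
      using W unfolding L by (auto simp: C_def)
  qed (use arrangementD[OF A] CB in auto)
  then have "poset_moebius (intersection_poset C) UNIV W = poset_moebius (intersection_poset B) UNIV W"
    if "W \<in> intersection_poset C" for W
    using that moebius_eq_whitney_sum[OF C] moebius_eq_whitney_sum[OF A] unfolding L by simp
  then show ?thesis
    using card_chambers_eq_sum_moebius[OF C] unfolding L[symmetric] C_def[symmetric] by simp
qed

section \<open>Diagonalizable matrices and their characteristic polynomials\<close>

unbundle no vec_syntax

text \<open>The indices \<open>p\<close> and \<open>Suc p\<close> are the first two of the first
  block of size at least two; their unit vectors form a Jordan chain.\<close>

lemma jordan_matrix_diagonal_or_chain:
  assumes "0 \<notin> fst ` set n_as"
  shows "diagonal_mat (jordan_matrix n_as) \<or>
    (\<exists>p a. Suc p < sum_list (map fst n_as) \<and> (\<forall>i < sum_list (map fst n_as).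
       jordan_matrix n_as $$ (i, p) = (if i = p then a else 0) \<and>
       jordan_matrix n_as $$ (i, Suc p) = (if i = Suc p then a else if i = p then 1 else (0 :: 'a :: field))))"
  using assms
proof (induction n_as)
  case Nil
  then show ?case by (simp add: diagonal_mat_def)
next
  case (Cons x n_as)
  obtain n a where x: "x = (n, a)" by force
  let ?N = "sum_list (map fst n_as)"
  let ?J = "jordan_matrix n_as"
  let ?F = "four_block_mat (jordan_block n a) (0\<^sub>m n ?N) (0\<^sub>m ?N n) ?J"
  have J: "jordan_matrix (x # n_as) = ?F" unfolding x jordan_matrix_Cons ..
  have n: "n > 0" and IH0: "0 \<notin> fst ` set n_as" using Cons.prems x by auto
  have ent: "?F $$ (i, j) = (if i < n then if j < n then jordan_block n a $$ (i, j) else 0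
     else if j < n then 0 else ?J $$ (i - n, j - n))" if "i < n + ?N" "j < n + ?N" for i j
    using that by (auto simp: index_mat_four_block)
  show ?case
  proof (cases "n = 1")
    case False
    with n have n2: "Suc 0 < n" by simp
    have "\<forall>i < n + ?N. ?F $$ (i, 0) = (if i = 0 then a else 0) \<and>
       ?F $$ (i, Suc 0) = (if i = Suc 0 then a else if i = 0 then 1 else 0)"
      using n2 by (auto simp: ent)
    with n2 show ?thesis unfolding J unfolding x by (intro disjI2 exI[of _ 0] exI[of _ a]) auto
  next
    case True
    from Cons.IH[OF IH0] show ?thesis
    proof
      assume d: "diagonal_mat ?J"
      have "diagonal_mat ?F"
        unfolding diagonal_mat_def
      proof (intro allI impI)
        fix i j assume ij: "i < dim_row ?F" "j < dim_col ?F" "i \<noteq> j"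
        then have "i < n + ?N" "j < n + ?N" by auto
        from ent[OF this] this ij(3) d True show "?F $$ (i, j) = 0"
          by (auto simp: diagonal_mat_def)
      qed
      then show ?thesis unfolding J by simp
    next
      assume "\<exists>p a. Suc p < ?N \<and> (\<forall>i < ?N. ?J $$ (i, p) = (if i = p then a else 0) \<and>
         ?J $$ (i, Suc p) = (if i = Suc p then a else if i = p then 1 else 0))"
      then obtain p b where p: "Suc p < ?N" "\<And>i. i < ?N \<Longrightarrow> ?J $$ (i, p) = (if i = p then b else 0)"
        "\<And>i. i < ?N \<Longrightarrow> ?J $$ (i, Suc p) = (if i = Suc p then b else if i = p then 1 else 0)"
        by blast
      have "?F $$ (i, n + p) = (if i = n + p then b else 0) \<and>
         ?F $$ (i, Suc (n + p)) = (if i = Suc (n + p) then b else if i = n + p then 1 else 0)"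
        if "i < n + ?N" for i
      proof (cases "i < n")
        case True
        then show ?thesis using p(1) by (simp add: ent)
      next
        case False
        then have "i - n < ?N" using that by simp
        from p(2,3)[OF this] show ?thesis using False that p(1)
          by (simp only: ent) (auto simp: ent Suc_diff_le)
      qed
      then show ?thesis unfolding J unfolding x using p(1)
        by (intro disjI2 exI[of _ "n + p"] exI[of _ b]) auto
    qed
  qed
qed

text \<open>The complex roots are eigenvalues, hence real, and the factorization descends along the
  injective embedding of polynomials.\<close>

lemma char_poly_splits_if_real_eigenvalues:
  fixes A :: "real mat"
  assumes A: "A \<in> carrier_mat n n"
    and real_ev: "\<And>c v. eigenvector (map_mat complex_of_real A) v c \<Longrightarrow> c \<in> \<real>"
  obtains as where "char_poly A = (\<Prod>a\<leftarrow>as. [:- a, 1:])"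
proof -
  interpret p: map_poly_inj_comm_ring_hom complex_of_real ..
  let ?A = "map_mat complex_of_real A"
  have A': "?A \<in> carrier_mat n n" using A by simp
  obtain cs where cs: "char_poly ?A = (\<Prod>a\<leftarrow>cs. [:- a, 1:])"
    using char_poly_factorized[OF A'] by blast
  have "c \<in> \<real>" if "c \<in> set cs" for c
  proof -
    have "poly (char_poly ?A) c = 0"
      unfolding cs using that by (simp add: poly_prod_list prod_list_zero_iff image_iff)
    then have "eigenvalue ?A c" using eigenvalue_root_char_poly[OF A'] by simp
    then show ?thesis using real_ev unfolding eigenvalue_def by blast
  qed
  then have "map_poly complex_of_real (\<Prod>a\<leftarrow>map Re cs. [:- a, 1:]) = (\<Prod>a\<leftarrow>cs. [:- a, 1:])"
  proof (induction cs)
    case (Cons c cs)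
    have "map_poly complex_of_real [:- Re c, 1:] = [:- c, 1:]" using Cons.prems[of c] by simp
    with Cons show ?case by (simp only: list.map prod_list.Cons p.hom_mult) simp
  qed simp
  then have "map_poly complex_of_real (char_poly A) = map_poly complex_of_real (\<Prod>a\<leftarrow>map Re cs. [:- a, 1:])"
    using cs of_real_hom.char_poly_hom[OF A, where 'a = complex] by simp
  then have "char_poly A = (\<Prod>a\<leftarrow>map Re cs. [:- a, 1:])" by simp
  then show thesis by (rule that)
qed

text \<open>A nontrivial Jordan block carries a chain of unit vectors. The change of basis
  \<open>P\<close> transports it to \<open>A\<close>, where \<open>no_chain\<close> kills the
  eigenvector, contrary to the invertibility of \<open>P\<close>.\<close>

lemma diagonalizable_if_no_jordan_chain:
  fixes A :: "real mat"
  assumes A: "A \<in> carrier_mat n n"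
    and real_ev: "\<And>c v. eigenvector (map_mat complex_of_real A) v c \<Longrightarrow> c \<in> \<real>"
    and no_chain: "\<And>a u v. u \<in> carrier_vec n \<Longrightarrow> v \<in> carrier_vec n \<Longrightarrow>
      A *\<^sub>v u = a \<cdot>\<^sub>v u + v \<Longrightarrow> A *\<^sub>v v = a \<cdot>\<^sub>v v \<Longrightarrow> v = 0\<^sub>v n"
  shows "diagonalizable A"
proof -
  obtain as where "char_poly A = (\<Prod>a\<leftarrow>as. [:- a, 1:])"
    using char_poly_splits_if_real_eigenvalues[OF A real_ev] .
  from jordan_nf_exists[OF A this] obtain n_as where "jordan_nf A n_as" ..
  then have n_as: "0 \<notin> fst ` set n_as" and sim: "similar_mat A (jordan_matrix n_as)"
    unfolding jordan_nf_def by auto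
  let ?J = "jordan_matrix n_as"
  obtain n' P Q where *: "{A, ?J, P, Q} \<subseteq> carrier_mat n' n'" "P * Q = 1\<^sub>m n'" "Q * P = 1\<^sub>m n'" "A = P * ?J * Q"
    using similar_matD[OF sim] by blast
  then have n': "n' = n" using A by auto
  note * = *[unfolded n']
  have J: "?J \<in> carrier_mat n n" and P: "P \<in> carrier_mat n n" and Q: "Q \<in> carrier_mat n n" using * by auto
  have N: "sum_list (map fst n_as) = n" using J by auto
  from jordan_matrix_diagonal_or_chain[OF n_as] have "diagonal_mat ?J"
  proof
    assume "\<exists>p a. Suc p < sum_list (map fst n_as) \<and> (\<forall>i < sum_list (map fst n_as).
       ?J $$ (i, p) = (if i = p then a else 0) \<and>
       ?J $$ (i, Suc p) = (if i = Suc p then a else if i = p then 1 else 0))"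
    then obtain p a where p: "Suc p < n" "\<And>i. i < n \<Longrightarrow> ?J $$ (i, p) = (if i = p then a else 0)"
        "\<And>i. i < n \<Longrightarrow> ?J $$ (i, Suc p) = (if i = Suc p then a else if i = p then 1 else 0)"
      unfolding N by blast
    let ?u = "unit_vec n (Suc p) :: real vec" and ?v = "unit_vec n p :: real vec"
    have Jv: "?J *\<^sub>v ?v = a \<cdot>\<^sub>v ?v" and Ju: "?J *\<^sub>v ?u = a \<cdot>\<^sub>v ?u + ?v"
      using p J by (auto intro!: eq_vecI simp: N)
    have conj: "A *\<^sub>v (P *\<^sub>v x) = P *\<^sub>v (?J *\<^sub>v x)" if x: "x \<in> carrier_vec n" for x
    proof -
      have "A *\<^sub>v (P *\<^sub>v x) = (P * ?J * (Q * P)) *\<^sub>v x"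
        using x J P Q by (subst *(4)) (simp add: assoc_mult_mat_vec[of _ n n _ n] assoc_mult_mat[of _ n n _ n _ n])
      then show ?thesis using x J P *(3) by (simp add: assoc_mult_mat_vec[of _ n n _ n])
    qed
    have uv: "?u \<in> carrier_vec n" "?v \<in> carrier_vec n" by simp_all
    have "P *\<^sub>v ?v = 0\<^sub>v n"
    proof (rule no_chain)
      show "A *\<^sub>v (P *\<^sub>v ?u) = a \<cdot>\<^sub>v (P *\<^sub>v ?u) + P *\<^sub>v ?v"
        unfolding conj[OF uv(1)] Ju using P uv
        by (subst mult_add_distrib_mat_vec[OF P]) (auto simp: mult_mat_vec[OF P])
      show "A *\<^sub>v (P *\<^sub>v ?v) = a \<cdot>\<^sub>v (P *\<^sub>v ?v)"
        unfolding conj[OF uv(2)] Jv using P uv by (simp add: mult_mat_vec[OF P])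
    qed (use P in auto)
    then have "Q *\<^sub>v (P *\<^sub>v ?v) = 0\<^sub>v n" using Q by (intro eq_vecI) auto
    then have "?v = 0\<^sub>v n"
      using P Q *(3) by (simp add: assoc_mult_mat_vec[symmetric, of Q n n P n])
    then have "?v $ p = 0" using p(1) by simp
    then show ?thesis using p(1) by simp
  qed
  with sim show ?thesis unfolding diagonalizable_def by blast
qed

section \<open>Multiplicities from traces of powers\<close>

lemma sum_diag_mult_commute:
  fixes X Y :: "'a :: comm_semiring_0 mat"
  assumes "X \<in> carrier_mat n n" "Y \<in> carrier_mat n n"
  shows "(\<Sum>i<n. (X * Y) $$ (i, i)) = (\<Sum>i<n. (Y * X) $$ (i, i))"
proof -
  have "(\<Sum>i<n. (X * Y) $$ (i, i)) = (\<Sum>i<n. \<Sum>k<n. X $$ (i, k) * Y $$ (k, i))"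
    using assms by (intro sum.cong refl) (auto simp: scalar_prod_def atLeast0LessThan)
  also have "\<dots> = (\<Sum>k<n. \<Sum>i<n. Y $$ (k, i) * X $$ (i, k))"
    by (subst sum.swap) (simp add: mult.commute)
  also have "\<dots> = (\<Sum>i<n. (Y * X) $$ (i, i))"
    using assms by (intro sum.cong refl) (auto simp: scalar_prod_def atLeast0LessThan)
  finally show ?thesis .
qed

lemma diagonal_mat_pow:
  fixes D :: "'a :: comm_semiring_1 mat"
  assumes D: "D \<in> carrier_mat n n" "diagonal_mat D"
  shows "i < n \<Longrightarrow> j < n \<Longrightarrow> (D ^\<^sub>m k) $$ (i, j) = (if i = j then (D $$ (i, i)) ^ k else 0)"
proof (induction k arbitrary: i j)
  case (Suc k)
  have "(D ^\<^sub>m Suc k) $$ (i, j) = (\<Sum>l<n. (D ^\<^sub>m k) $$ (i, l) * D $$ (l, j))"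
    using Suc.prems D(1) by (simp add: scalar_prod_def atLeast0LessThan)
  also have "\<dots> = (\<Sum>l<n. if l = j then (D ^\<^sub>m k) $$ (i, l) * D $$ (l, l) else 0)"
    using D Suc.prems by (intro sum.cong) (auto simp: diagonal_mat_def)
  also have "\<dots> = (D ^\<^sub>m k) $$ (i, j) * D $$ (j, j)" using Suc.prems by simp
  finally show ?case using Suc by (auto simp: mult.commute)
qed (use D in simp)

text \<open>Power sums determine the sum of every polynomial over the diagonal, and a polynomial
  that vanishes at all values but one isolates a multiplicity. As \<open>l\<close> may repeat
  values, multiplicities are compared value by value.\<close>

lemma char_poly_eq_from_power_sums:
  fixes A :: "real mat" and m :: "'l \<Rightarrow> nat"
  assumes A: "A \<in> carrier_mat n n" and diag: "diagonalizable A" and L: "finite L"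
    and power_sums: "\<And>k. (\<Sum>i<n. (A ^\<^sub>m k) $$ (i, i)) = (\<Sum>W\<in>L. real (m W) * l W ^ k)"
  shows "char_poly A = (\<Prod>W\<in>L. [:- l W, 1:] ^ m W)"
proof -
  obtain D where D: "diagonal_mat D" "similar_mat A D" using diag unfolding diagonalizable_def by blast
  obtain n' P Q where *: "{A, D, P, Q} \<subseteq> carrier_mat n' n'" "P * Q = 1\<^sub>m n'" "Q * P = 1\<^sub>m n'" "A = P * D * Q"
    using similar_matD[OF D(2)] by blast
  then have n': "n' = n" using A by auto
  note * = *[unfolded n']
  have Dc: "D \<in> carrier_mat n n" and P: "P \<in> carrier_mat n n" and Q: "Q \<in> carrier_mat n n" using * by auto
  define d where "d i = D $$ (i, i)" for i
  have tr: "(\<Sum>i<n. (A ^\<^sub>m k) $$ (i, i)) = (\<Sum>i<n. d i ^ k)" for k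
  proof -
    have "similar_mat_wit A D P Q" using * unfolding similar_mat_wit_def Let_def by auto
    from similar_mat_wit_pow_id[OF this] have "A ^\<^sub>m k = P * D ^\<^sub>m k * Q" .
    then have "(\<Sum>i<n. (A ^\<^sub>m k) $$ (i, i)) = (\<Sum>i<n. (Q * (P * D ^\<^sub>m k)) $$ (i, i))"
      using sum_diag_mult_commute[of "P * D ^\<^sub>m k" n Q] P Q Dc by simp
    also have "Q * (P * D ^\<^sub>m k) = D ^\<^sub>m k"
      using P Q Dc *(3) by (simp add: assoc_mult_mat[symmetric, of Q n n P n _ n])
    finally show ?thesis using diagonal_mat_pow[OF Dc D(1)] by (simp add: d_def)
  qed
  have polys: "(\<Sum>i<n. poly q (d i)) = (\<Sum>W\<in>L. real (m W) * poly q (l W))" for q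
  proof -
    have "(\<Sum>i<n. poly q (d i)) = (\<Sum>k\<le>degree q. coeff q k * (\<Sum>i<n. d i ^ k))"
      by (simp add: poly_altdef sum_distrib_left sum.swap[of _ "{..<n}"])
    also have "\<dots> = (\<Sum>k\<le>degree q. coeff q k * (\<Sum>W\<in>L. real (m W) * l W ^ k))"
      using tr power_sums by simp
    also have "\<dots> = (\<Sum>W\<in>L. real (m W) * poly q (l W))"
      by (simp add: poly_altdef sum_distrib_left sum.swap[of _ "{..degree q}"] mult_ac)
    finally show ?thesis .
  qed
  \<comment> \<open>Contains the values from both sides, so that \<open>q\<close> below annihilates
    the unwanted terms of either sum.\<close>
  define S where "S = d ` {..<n} \<union> l ` L"
  have S: "finite S" using L by (simp add: S_def)
  have mult: "card {i \<in> {..<n}. d i = a} = (\<Sum>W\<in>{W \<in> L. l W = a}. m W)" for a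
  proof -
    \<comment> \<open>A Lagrange polynomial without normalization: its nonzero value at
      \<open>a\<close> cancels.\<close>
    define q where "q = (\<Prod>b\<in>S - {a}. [:- b, 1:])"
    have q0: "poly q b = 0" if "b \<in> S" "b \<noteq> a" for b
      unfolding q_def using that S by (auto simp: poly_prod)
    have qa: "poly q a \<noteq> 0" unfolding q_def using S by (auto simp: poly_prod)
    have "(\<Sum>i<n. poly q (d i)) = (\<Sum>i<n. if d i = a then poly q a else 0)"
      by (intro sum.cong) (auto intro!: q0 simp: S_def)
    also have "\<dots> = real (card {i \<in> {..<n}. d i = a}) * poly q a"
      by (subst sum.inter_filter[symmetric]) auto
    finally have 1: "(\<Sum>i<n. poly q (d i)) = real (card {i \<in> {..<n}. d i = a}) * poly q a" .
    have "(\<Sum>W\<in>L. real (m W) * poly q (l W)) = (\<Sum>W\<in>L. if l W = a then real (m W) * poly q a else 0)"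
      by (intro sum.cong) (auto intro!: q0 simp: S_def)
    also have "\<dots> = real (\<Sum>W\<in>{W \<in> L. l W = a}. m W) * poly q a"
      by (subst sum.inter_filter[symmetric, OF L]) (auto simp: sum_distrib_right)
    finally have 2: "(\<Sum>W\<in>L. real (m W) * poly q (l W)) = real (\<Sum>W\<in>{W \<in> L. l W = a}. m W) * poly q a" .
    have "real (card {i \<in> {..<n}. d i = a}) * poly q a = real (\<Sum>W\<in>{W \<in> L. l W = a}. m W) * poly q a"
      by (rule trans[OF trans[OF sym[OF 1] polys] 2])
    with qa show ?thesis by (simp only: mult_cancel_right of_nat_eq_iff) simp
  qed
  have "char_poly A = char_poly D" using char_poly_similar[OF D(2)] .
  also have "\<dots> = (\<Prod>a\<leftarrow>diag_mat D. [:- a, 1:])"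
    by (rule char_poly_upper_triangular[OF Dc]) (use D(1) Dc in \<open>auto simp: diagonal_mat_def\<close>)
  also have "\<dots> = (\<Prod>i<n. [:- d i, 1:])"
    using Dc by (simp add: diag_mat_def d_def comp_def prod.distinct_set_conv_list[symmetric] atLeast0LessThan)
  also have "\<dots> = (\<Prod>a\<in>S. \<Prod>i\<in>{i \<in> {..<n}. d i = a}. [:- d i, 1:])"
    by (rule prod.group[symmetric]) (use S in \<open>auto simp: S_def\<close>)
  also have "\<dots> = (\<Prod>a\<in>S. [:- a, 1:] ^ card {i \<in> {..<n}. d i = a})"
    by (intro prod.cong refl) simp
  also have "\<dots> = (\<Prod>a\<in>S. \<Prod>W\<in>{W \<in> L. l W = a}. [:- l W, 1:] ^ m W)"
    unfolding mult power_sum by (intro prod.cong refl) simp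
  also have "\<dots> = (\<Prod>W\<in>L. [:- l W, 1:] ^ m W)"
    by (rule prod.group) (use S L in \<open>auto simp: S_def\<close>)
  finally show ?thesis .
qed

text \<open>Transposing the similarity exchanges \<open>P\<close> and \<open>Q\<close>. For the
  walk, chains of left vectors are excluded, that is, chains of the transposed kernel.\<close>

lemma diagonalizable_transpose:
  assumes A: "A \<in> carrier_mat n n" and diag: "diagonalizable (transpose_mat A)"
  shows "diagonalizable (A :: 'a :: field mat)"
proof -
  obtain D where D: "diagonal_mat D" "similar_mat (transpose_mat A) D"
    using diag unfolding diagonalizable_def by blast
  obtain n' P Q where *: "{transpose_mat A, D, P, Q} \<subseteq> carrier_mat n' n'" "P * Q = 1\<^sub>m n'" "Q * P = 1\<^sub>m n'"
    "transpose_mat A = P * D * Q"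
    using similar_matD[OF D(2)] by blast
  have "transpose_mat A \<in> carrier_mat n' n'" using *(1) by blast
  then have n': "n' = n" using A carrier_matD by force
  note * = *[unfolded n']
  have Dc: "D \<in> carrier_mat n n" and P: "P \<in> carrier_mat n n" and Q: "Q \<in> carrier_mat n n" using * by auto
  have "similar_mat A (transpose_mat D)"
  proof (rule similar_matI)
    show "{A, transpose_mat D, transpose_mat Q, transpose_mat P} \<subseteq> carrier_mat n n" using A Dc P Q by auto
    show "transpose_mat Q * transpose_mat P = 1\<^sub>m n"
      using *(2) transpose_mult[OF P Q] by simp
    show "transpose_mat P * transpose_mat Q = 1\<^sub>m n"
      using *(3) transpose_mult[OF Q P] by simp
    have "A = transpose_mat (P * D * Q)" using *(4) by (metis transpose_transpose)
    also have "\<dots> = transpose_mat Q * (transpose_mat D * transpose_mat P)"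
      using P Q Dc by (simp add: transpose_mult[of _ n n _ n])
    finally show "A = transpose_mat Q * transpose_mat D * transpose_mat P"
      using P Q Dc by (simp add: assoc_mult_mat[of _ n n _ n _ n])
  qed
  moreover have "diagonal_mat (transpose_mat D)" using D(1) Dc by (auto simp: diagonal_mat_def)
  ultimately show ?thesis unfolding diagonalizable_def by blast
qed

section \<open>Finite Markov chains\<close>

text \<open>Row sums one give the eigenvalue one for the matrix, hence for its transpose, so a
  nonzero signed vector \<open>v\<close> is fixed from the left. Its absolute value is fixed as well
  and can be normalized.\<close>

lemma stationary_exists:
  assumes S: "finite S" "S \<noteq> {}"
    and nonneg: "\<And>x y. x \<in> S \<Longrightarrow> y \<in> S \<Longrightarrow> K x y \<ge> 0"
    and rows: "\<And>x. x \<in> S \<Longrightarrow> (\<Sum>y\<in>S. K x y) = 1"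
  shows "\<exists>p. stationary S K p"
proof -
  define n where "n = card S"
  obtain e where e: "bij_betw e {..<n} S"
    using ex_bij_betw_nat_finite[OF S(1)] by (auto simp: n_def atLeast0LessThan)
  have n: "n > 0" using S by (simp add: n_def card_gt_0_iff)
  have eS: "e i \<in> S" if "i < n" for i using bij_betwE[OF e] that by simp
  have reindex: "(\<Sum>x\<in>S. f x) = (\<Sum>i<n. f (e i))" for f :: "_ \<Rightarrow> real"
    using sum.reindex_bij_betw[OF e, of f] by simp
  define A where "A = kernel_mat n e K"
  have A: "A \<in> carrier_mat n n" by (simp add: A_def kernel_mat_def)
  have Aij: "A $$ (i, j) = K (e i) (e j)" if "i < n" "j < n" for i j
    using that by (simp add: A_def kernel_mat_def)
  have "eigenvector A (vec n (\<lambda>_. 1)) 1"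
    unfolding eigenvector_def
  proof (intro conjI)
    show "vec n (\<lambda>_. 1) \<in> carrier_vec (dim_row A)" using A by simp
    have "vec n (\<lambda>_. 1 :: real) $ 0 \<noteq> 0\<^sub>v n $ 0" using n by simp
    then show "vec n (\<lambda>_. 1 :: real) \<noteq> 0\<^sub>v (dim_row A)" using A by (metis carrier_matD(1))
    show "A *\<^sub>v vec n (\<lambda>_. 1) = 1 \<cdot>\<^sub>v vec n (\<lambda>_. 1)"
    proof (rule eq_vecI)
      fix i assume "i < dim_vec (1 \<cdot>\<^sub>v vec n (\<lambda>_. 1 :: real))"
      then have i: "i < n" by simp
      have "(A *\<^sub>v vec n (\<lambda>_. 1)) $ i = (\<Sum>j<n. A $$ (i, j))"
        using A i by (simp add: scalar_prod_def atLeast0LessThan)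
      also have "\<dots> = (\<Sum>y\<in>S. K (e i) y)" unfolding reindex using i by (intro sum.cong) (auto simp: Aij)
      also have "\<dots> = 1" using rows[OF eS[OF i]] .
      finally show "(A *\<^sub>v vec n (\<lambda>_. 1)) $ i = (1 \<cdot>\<^sub>v vec n (\<lambda>_. 1)) $ i" using i by simp
    qed (use A in auto)
  qed
  then have "eigenvalue A 1" unfolding eigenvalue_def by blast
  then have "eigenvalue (transpose_mat A) 1"
    using eigenvalue_root_char_poly[OF A] eigenvalue_root_char_poly[of "transpose_mat A" n]
      char_poly_transpose_mat[OF A] A by simp
  then obtain v where v: "v \<in> carrier_vec n" "v \<noteq> 0\<^sub>v n" "transpose_mat A *\<^sub>v v = 1 \<cdot>\<^sub>v v"
    unfolding eigenvalue_def eigenvector_def using A by auto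
  have left: "(\<Sum>i<n. v $ i * K (e i) (e j)) = v $ j" if j: "j < n" for j
  proof -
    have "(transpose_mat A *\<^sub>v v) $ j = (\<Sum>i<n. v $ i * K (e i) (e j))"
      using A v(1) j by (simp add: scalar_prod_def atLeast0LessThan Aij mult.commute)
    then show ?thesis using v j by simp
  qed
  have le: "\<bar>v $ j\<bar> \<le> (\<Sum>i<n. \<bar>v $ i\<bar> * K (e i) (e j))" if j: "j < n" for j
  proof -
    have "\<bar>v $ j\<bar> \<le> (\<Sum>i<n. \<bar>v $ i * K (e i) (e j)\<bar>)"
      unfolding left[OF j, symmetric] by (rule sum_abs)
    also have "\<dots> = (\<Sum>i<n. \<bar>v $ i\<bar> * K (e i) (e j))"
      using nonneg eS j by (intro sum.cong) (auto simp: abs_mult)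
    finally show ?thesis .
  qed
  \<comment> \<open>The triangle inequality holds entrywise and both totals coincide, so it is an
    equality in every entry.\<close>
  have "(\<Sum>j<n. \<Sum>i<n. \<bar>v $ i\<bar> * K (e i) (e j)) = (\<Sum>i<n. \<bar>v $ i\<bar> * (\<Sum>j<n. K (e i) (e j)))"
    by (subst sum.swap) (simp add: sum_distrib_left)
  also have "\<dots> = (\<Sum>i<n. \<bar>v $ i\<bar>)"
    using rows[unfolded reindex] eS by (intro sum.cong) auto
  finally have tot: "(\<Sum>j<n. (\<Sum>i<n. \<bar>v $ i\<bar> * K (e i) (e j)) - \<bar>v $ j\<bar>) = 0"
    by (simp add: sum_subtractf)
  have eq: "(\<Sum>i<n. \<bar>v $ i\<bar> * K (e i) (e j)) = \<bar>v $ j\<bar>" if "j < n" for j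
  proof -
    have "\<forall>j\<in>{..<n}. (\<Sum>i<n. \<bar>v $ i\<bar> * K (e i) (e j)) - \<bar>v $ j\<bar> = 0"
      by (rule sum_nonneg_eq_0_iff[THEN iffD1, OF _ _ tot]) (use le in auto)
    then show ?thesis using that by simp
  qed
  define c where "c = (\<Sum>i<n. \<bar>v $ i\<bar>)"
  have "\<exists>i<n. v $ i \<noteq> 0"
  proof (rule ccontr)
    assume "\<not> ?thesis"
    then have "v = 0\<^sub>v n" using v(1) by (intro eq_vecI) auto
    with v(2) show False by simp
  qed
  then have c: "c > 0" unfolding c_def by (auto intro!: sum_pos2)
  define g where "g = inv_into {..<n} e"
  have ge: "g (e i) = i" if "i < n" for i
    unfolding g_def using that e by (auto simp: bij_betw_def)
  define f where "f x = (if x \<in> S then \<bar>v $ g x\<bar> / c else 0)" for x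
  have f0: "f x \<ge> 0" for x using c by (simp add: f_def)
  have sumf: "(\<Sum>x\<in>S. f x) = 1"
  proof -
    have "(\<Sum>x\<in>S. f x) = (\<Sum>i<n. \<bar>v $ i\<bar> / c)"
      unfolding reindex by (intro sum.cong) (auto simp: f_def eS ge)
    also have "\<dots> = 1" using c by (simp add: c_def flip: sum_divide_distrib)
    finally show ?thesis .
  qed
  have "(\<integral>\<^sup>+x. ennreal (f x) \<partial>count_space UNIV) = (\<integral>\<^sup>+x. ennreal (f x) * indicator S x \<partial>count_space UNIV)"
    by (intro nn_integral_cong) (auto simp: f_def indicator_def)
  also have "\<dots> = (\<integral>\<^sup>+x. ennreal (f x) \<partial>count_space S)"
    by (simp add: nn_integral_count_space_indicator)
  also have "\<dots> = (\<Sum>x\<in>S. ennreal (f x))" by (rule nn_integral_count_space_finite[OF S(1)])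
  also have "\<dots> = 1" using sumf f0 by (simp add: sum_ennreal)
  finally have pmf_f: "pmf (embed_pmf f) x = f x" for x using f0 by (intro pmf_embed_pmf) auto
  have "stationary S K (embed_pmf f)"
    unfolding stationary_def
  proof (intro conjI ballI)
    show "set_pmf (embed_pmf f) \<subseteq> S" by (auto simp: set_pmf_iff pmf_f f_def split: if_splits)
    fix y assume "y \<in> S"
    then obtain j where j: "j < n" "y = e j" using e by (auto simp: bij_betw_def)
    have "(\<Sum>x\<in>S. pmf (embed_pmf f) x * K x y) = (\<Sum>i<n. \<bar>v $ i\<bar> * K (e i) (e j)) / c"
      unfolding reindex pmf_f j(2) sum_divide_distrib by (intro sum.cong) (auto simp: f_def eS ge)
    also have "\<dots> = pmf (embed_pmf f) y" unfolding eq[OF j(1)] pmf_f using j eS by (simp add: f_def ge)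
    finally show "(\<Sum>x\<in>S. pmf (embed_pmf f) x * K x y) = pmf (embed_pmf f) y" .
  qed
  then show ?thesis ..
qed

lemma kernel_mat_pow:
  assumes e: "bij_betw e {..<N} S"
  shows "i < N \<Longrightarrow> j < N \<Longrightarrow> (kernel_mat N e K ^\<^sub>m l) $$ (i, j) = kernel_pow S K l (e i) (e j)"
proof (induction l arbitrary: j)
  case 0
  then show ?case using bij_betw_imp_inj_on[OF e] by (auto simp: kernel_mat_def inj_on_def)
next
  case (Suc l)
  have car: "kernel_mat N e K \<in> carrier_mat N N" by (simp add: kernel_mat_def)
  have "(kernel_mat N e K ^\<^sub>m Suc l) $$ (i, j) = (\<Sum>k<N. (kernel_mat N e K ^\<^sub>m l) $$ (i, k) * kernel_mat N e K $$ (k, j))"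
    using Suc.prems car by (simp add: scalar_prod_def atLeast0LessThan)
  also have "\<dots> = (\<Sum>k<N. kernel_pow S K l (e i) (e k) * K (e k) (e j))"
    using Suc by (intro sum.cong) (auto simp: kernel_mat_def)
  also have "\<dots> = (\<Sum>z\<in>S. kernel_pow S K l (e i) z * K z (e j))"
    by (rule sum.reindex_bij_betw[OF e])
  finally show ?case by simp
qed

lemma prob_replicate_pmf_all:
  "measure_pmf.prob (replicate_pmf l w) {Fs. \<forall>F\<in>set Fs. P F} = measure_pmf.prob w {F. P F} ^ l"
proof (induction l)
  case (Suc l)
  have "replicate_pmf (Suc l) w = map_pmf (\<lambda>(x, xs). x # xs) (pair_pmf w (replicate_pmf l w))"
    by (simp add: pair_pmf_def map_bind_pmf)
  then have "measure_pmf.prob (replicate_pmf (Suc l) w) {Fs. \<forall>F\<in>set Fs. P F} =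
      measure_pmf.prob (pair_pmf w (replicate_pmf l w)) ({F. P F} \<times> {Fs. \<forall>F\<in>set Fs. P F})"
    by (simp only: measure_map_pmf) (rule arg_cong[where f = "measure_pmf.prob _"], auto)
  \<comment> \<open>Cutting down to the supports makes both factors countable, as the product
    formula expects.\<close>
  also have "\<dots> = measure_pmf.prob (pair_pmf w (replicate_pmf l w))
      (({F. P F} \<inter> set_pmf w) \<times> ({Fs. \<forall>F\<in>set Fs. P F} \<inter> set_pmf (replicate_pmf l w)))"
    by (subst (1 2) measure_Int_set_pmf[symmetric]) (rule arg_cong[where f = "measure_pmf.prob _"], auto)
  also have "\<dots> = measure_pmf.prob w {F. P F} * measure_pmf.prob (replicate_pmf l w) {Fs. \<forall>F\<in>set Fs. P F}"
    by (subst measure_pmf_prob_product) (auto simp: measure_Int_set_pmf)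
  finally show ?case using Suc by simp
qed simp

text \<open>A random walk driven by a finite set \<open>T\<close> of maps on \<open>S\<close>.  The relation \<open>lies\<close> stands for
  containment of a face in a hyperplane, \<open>absorb\<close> is the deletion property of a left regular
  band: a map that lies on every hyperplane shared by the letters of a word does not change
  the effect of that word.\<close>

locale absorbing_walk =
  fixes S :: "'s set" and T :: "'f set" and w :: "'f pmf" and act :: "'f \<Rightarrow> 's \<Rightarrow> 's"
    and B :: "'h set" and lies :: "'f \<Rightarrow> 'h \<Rightarrow> bool"
  assumes finite_S: "finite S" and finite_T: "finite T" and finite_B: "finite B"
    and S_nonempty: "S \<noteq> {}"
    and set_w: "set_pmf w \<subseteq> T"
    and act_closed: "F \<in> T \<Longrightarrow> x \<in> S \<Longrightarrow> act F x \<in> S"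
    and absorb: "set g \<subseteq> T \<Longrightarrow> F \<in> T \<Longrightarrow> x \<in> S \<Longrightarrow>
      (\<And>H. H \<in> B \<Longrightarrow> (\<And>G. G \<in> set g \<Longrightarrow> lies G H) \<Longrightarrow> lies F H) \<Longrightarrow>
      foldr act g (act F x) = foldr act g x"
    and merge: "set g \<subseteq> T \<Longrightarrow> x \<in> S \<Longrightarrow> y \<in> S \<Longrightarrow>
      (\<And>H. H \<in> B \<Longrightarrow> \<exists>G\<in>set g. \<not> lies G H) \<Longrightarrow> foldr act g x = foldr act g y"
begin

definition kernel :: "'s \<Rightarrow> 's \<Rightarrow> real" where
  "kernel x y = (\<Sum>F\<in>{F \<in> T. act F x = y}. pmf w F)"

lemma sum_kernel:
  assumes x: "x \<in> S"
  shows "(\<Sum>y\<in>S. of_real (kernel x y) * f y) = (\<Sum>F\<in>T. of_real (pmf w F) * f (act F x) :: 'a :: real_field)"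
proof -
  have "(\<Sum>F\<in>T. of_real (pmf w F) * f (act F x)) =
      (\<Sum>y\<in>S. \<Sum>F\<in>{F \<in> T. act F x = y}. of_real (pmf w F) * f (act F x))"
    by (rule sum.group[symmetric]) (use finite_S finite_T act_closed x in auto)
  also have "\<dots> = (\<Sum>y\<in>S. of_real (kernel x y) * f y)"
    by (intro sum.cong refl) (simp add: kernel_def sum_distrib_right)
  finally show ?thesis by simp
qed

lemma sum_kernel_real:
  "x \<in> S \<Longrightarrow> (\<Sum>y\<in>S. kernel x y * f y) = (\<Sum>F\<in>T. pmf w F * f (act F x))"
  using sum_kernel[where 'a = real, of x f] by simp

lemma sum_w: "(\<Sum>F\<in>T. pmf w F) = 1"
  by (rule sum_pmf_eq_1[OF finite_T set_w])

section \<open>Words of letters and the triangular system\<close>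

lemma foldr_closed: "set g \<subseteq> T \<Longrightarrow> x \<in> S \<Longrightarrow> foldr act g x \<in> S"
  by (induction g) (auto intro: act_closed)

text \<open>The letters that a word absorbs: for faces, those inside every hyperplane of
  \<open>B\<close> that contains all letters of \<open>g\<close>. The shadow stands in for the flat
  supporting the word, without geometry in the locale.\<close>

definition shadow :: "'f list \<Rightarrow> 'f set" where
  "shadow g = {F \<in> T. \<forall>H\<in>B. (\<forall>G\<in>set g. lies G H) \<longrightarrow> lies F H}"

definition shadow_mass :: "'f list \<Rightarrow> real" where
  "shadow_mass g = (\<Sum>F\<in>shadow g. pmf w F)"

lemma finite_shadow: "finite (shadow g)"
  using finite_T by (simp add: shadow_def)

lemma shadow_append: "F \<in> T - shadow g \<Longrightarrow> insert F (shadow g) \<subseteq> shadow (g @ [F])"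
  unfolding shadow_def by auto

text \<open>A letter of weight zero may enlarge the shadow without its mass, but it has coefficient
  zero in \<open>pairing_kernel\<close>.\<close>

lemma shadow_mass_strict:
  assumes "F \<in> T - shadow g" "pmf w F \<noteq> 0"
  shows "shadow_mass g < shadow_mass (g @ [F])"
proof -
  have "shadow_mass g < pmf w F + shadow_mass g" using assms(2) pmf_nonneg[of w F] by linarith
  also have "\<dots> = (\<Sum>F\<in>insert F (shadow g). pmf w F)"
    using assms finite_shadow by (simp add: shadow_mass_def)
  also have "\<dots> \<le> shadow_mass (g @ [F])"
    unfolding shadow_mass_def by (intro sum_mono2 finite_shadow shadow_append assms(1)) auto
  finally show ?thesis .
qed

text \<open>The measure for inductions on words: they get longer while fewer letters remain outside
  the shadow.\<close>

lemma card_shadow: "F \<in> T - shadow g \<Longrightarrow> card (T - shadow (g @ [F])) < card (T - shadow g)"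
  using shadow_append[of F g] finite_T by (intro psubset_card_mono) (auto simp: shadow_def)

text \<open>The row vector \<open>v\<close> times the operator of \<open>g\<close>, tested on a
  function \<open>f\<close>. For the empty word, indicator functions return the entries of
  \<open>v\<close>.\<close>

definition pairing :: "('s \<Rightarrow> 'a :: real_field) \<Rightarrow> 'f list \<Rightarrow> ('s \<Rightarrow> 'a) \<Rightarrow> 'a" where
  "pairing v g f = (\<Sum>x\<in>S. v x * f (foldr act g x))"

lemma pairing_Nil: "x \<in> S \<Longrightarrow> pairing v [] (\<lambda>y. if y = x then 1 else 0) = v x"
  unfolding pairing_def using finite_S by (simp add: if_distrib cong: if_cong)

text \<open>The letters in the shadow of \<open>g\<close> are absorbed, all others strictly enlarge the shadow;
  ordered by shadows, the left action of the kernel is therefore triangular, with diagonal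
  entries \<open>shadow_mass g\<close>.\<close>

lemma pairing_kernel:
  assumes g: "set g \<subseteq> T" and v': "\<And>y. y \<in> S \<Longrightarrow> v' y = (\<Sum>x\<in>S. v x * of_real (kernel x y))"
  shows "pairing v' g f = of_real (shadow_mass g) * pairing v g f +
    (\<Sum>F\<in>T - shadow g. of_real (pmf w F) * pairing v (g @ [F]) f)"
proof -
  have "pairing v' g f = (\<Sum>y\<in>S. \<Sum>x\<in>S. v x * of_real (kernel x y) * f (foldr act g y))"
    unfolding pairing_def by (intro sum.cong refl) (simp add: v' sum_distrib_right)
  also have "\<dots> = (\<Sum>x\<in>S. v x * (\<Sum>y\<in>S. of_real (kernel x y) * f (foldr act g y)))"
    by (subst sum.swap) (simp add: sum_distrib_left mult.assoc)
  also have "\<dots> = (\<Sum>x\<in>S. v x * (\<Sum>F\<in>T. of_real (pmf w F) * f (foldr act g (act F x))))"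
    by (intro sum.cong refl) (simp add: sum_kernel)
  also have "\<dots> = (\<Sum>F\<in>T. of_real (pmf w F) * pairing v (g @ [F]) f)"
    unfolding pairing_def sum_distrib_left by (subst sum.swap) (simp add: mult_ac)
  also have "\<dots> = (\<Sum>F\<in>shadow g. of_real (pmf w F) * pairing v (g @ [F]) f) +
      (\<Sum>F\<in>T - shadow g. of_real (pmf w F) * pairing v (g @ [F]) f)"
    using finite_T by (subst add.commute, intro sum.subset_diff) (auto simp: shadow_def)
  also have "(\<Sum>F\<in>shadow g. of_real (pmf w F) * pairing v (g @ [F]) f) =
      (\<Sum>F\<in>shadow g. of_real (pmf w F) * pairing v g f)"
  proof (intro sum.cong refl)
    fix F assume F: "F \<in> shadow g"
    have "foldr act g (act F x) = foldr act g x" if "x \<in> S" for x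
      using F by (intro absorb g that) (auto simp: shadow_def)
    then show "of_real (pmf w F) * pairing v (g @ [F]) f = of_real (pmf w F) * pairing v g f"
      unfolding pairing_def by simp
  qed
  also have "\<dots> = of_real (shadow_mass g) * pairing v g f"
    by (simp add: shadow_mass_def sum_distrib_right)
  finally show ?thesis .
qed

text \<open>A nonreal \<open>c\<close> differs from every diagonal entry of the triangular system,
  so the pairings vanish successively, from the words with largest shadow down to the empty
  word.\<close>

lemma left_eigenvalue_real:
  fixes v :: "'s \<Rightarrow> 'a :: real_field"
  assumes ev: "\<And>y. y \<in> S \<Longrightarrow> (\<Sum>x\<in>S. v x * of_real (kernel x y)) = c * v y"
    and c: "c \<notin> \<real>" and x: "x \<in> S"
  shows "v x = 0"
proof -
  have "pairing v g f = 0" if "set g \<subseteq> T" for g f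
    using that
  proof (induction "card (T - shadow g)" arbitrary: g rule: less_induct)
    case less
    have "c * pairing v g f = pairing (\<lambda>y. c * v y) g f"
      by (simp add: pairing_def sum_distrib_left mult_ac)
    also have "\<dots> = of_real (shadow_mass g) * pairing v g f +
        (\<Sum>F\<in>T - shadow g. of_real (pmf w F) * pairing v (g @ [F]) f)"
      using ev by (intro pairing_kernel less.prems) simp
    also have "(\<Sum>F\<in>T - shadow g. of_real (pmf w F) * pairing v (g @ [F]) f) = 0"
      using less.prems less.hyps card_shadow by (intro sum.neutral) auto
    finally have "(c - of_real (shadow_mass g)) * pairing v g f = 0" by (simp add: algebra_simps)
    moreover have "c \<noteq> of_real (shadow_mass g)" using c by auto
    ultimately show ?case by simp
  qed
  from this[of "[]" "\<lambda>y. if y = x then 1 else 0"] show ?thesis using pairing_Nil[OF x, of v] by simp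
qed

text \<open>The pairings of \<open>u\<close> and \<open>v\<close> with words of mass above \<open>a\<close> vanish.  As the masses increase strictly
  along the triangular system, a word of mass \<open>a\<close> feeds only on those, so its pairing with \<open>v\<close>
  vanishes as well.\<close>

lemma no_left_jordan_chain:
  fixes u v :: "'s \<Rightarrow> real"
  assumes u: "\<And>y. y \<in> S \<Longrightarrow> (\<Sum>x\<in>S. u x * kernel x y) = a * u y + v y"
    and v: "\<And>y. y \<in> S \<Longrightarrow> (\<Sum>x\<in>S. v x * kernel x y) = a * v y"
    and x: "x \<in> S"
  shows "v x = 0"
proof -
  have eqv: "a * pairing v g f = shadow_mass g * pairing v g f +
      (\<Sum>F\<in>T - shadow g. pmf w F * pairing v (g @ [F]) f)" if g: "set g \<subseteq> T" for g f
  proof -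
    have "a * pairing v g f = pairing (\<lambda>y. a * v y) g f"
      by (simp add: pairing_def sum_distrib_left mult_ac)
    with pairing_kernel[OF g, of "\<lambda>y. a * v y" v f] v show ?thesis by simp
  qed
  have equ: "a * pairing u g f + pairing v g f = shadow_mass g * pairing u g f +
      (\<Sum>F\<in>T - shadow g. pmf w F * pairing u (g @ [F]) f)" if g: "set g \<subseteq> T" for g f
  proof -
    have "a * pairing u g f + pairing v g f = pairing (\<lambda>y. a * u y + v y) g f"
      by (simp add: pairing_def sum_distrib_left sum.distrib algebra_simps)
    with pairing_kernel[OF g, of "\<lambda>y. a * u y + v y" u f] u show ?thesis by simp
  qed
  have above: "pairing v g f = 0 \<and> pairing u g f = 0" if "set g \<subseteq> T" "shadow_mass g > a" for g f
    using that
  proof (induction "card (T - shadow g)" arbitrary: g rule: less_induct)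
    case less
    have IH: "pmf w F * pairing v (g @ [F]) f = 0 \<and> pmf w F * pairing u (g @ [F]) f = 0"
      if F: "F \<in> T - shadow g" for F
    proof (cases "pmf w F = 0")
      case False
      have "shadow_mass (g @ [F]) > a" using shadow_mass_strict[OF F False] less.prems(2) by simp
      then show ?thesis using less.hyps[OF card_shadow[OF F]] less.prems(1) F by simp
    qed simp
    have "a * pairing v g f = shadow_mass g * pairing v g f"
      using eqv[OF less.prems(1), of f] IH by simp
    then have 0: "pairing v g f = 0" using less.prems(2) by simp
    then have "a * pairing u g f = shadow_mass g * pairing u g f"
      using equ[OF less.prems(1), of f] IH by simp
    then show ?case using less.prems(2) 0 by simp
  qed
  have "pairing v g f = 0" if "set g \<subseteq> T" for g f
    using that
  proof (induction "card (T - shadow g)" arbitrary: g rule: less_induct)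
    case less
    consider "shadow_mass g > a" | "shadow_mass g = a" | "shadow_mass g < a" by linarith
    then show ?case
    proof cases
      case 1
      then show ?thesis using above less.prems by blast
    next
      case 2
      have "pmf w F * pairing u (g @ [F]) f = 0" if F: "F \<in> T - shadow g" for F
      proof (cases "pmf w F = 0")
        case False
        have "shadow_mass (g @ [F]) > a" using shadow_mass_strict[OF F False] 2 by simp
        then show ?thesis using above[of "g @ [F]" f] less.prems F by simp
      qed simp
      then have "(\<Sum>F\<in>T - shadow g. pmf w F * pairing u (g @ [F]) f) = 0" by (intro sum.neutral ballI)
      then show ?thesis using equ[OF less.prems, of f] 2 by simp
    next
      case 3
      \<comment> \<open>Below mass \<open>a\<close> the diagonal entry again differs from
        \<open>a\<close>, and the induction already covers the longer words, so the equation for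
        \<open>v\<close> suffices.\<close>
      have "pairing v (g @ [F]) f = 0" if F: "F \<in> T - shadow g" for F
        using less.hyps[OF card_shadow[OF F]] less.prems F by simp
      then have "a * pairing v g f = shadow_mass g * pairing v g f"
        using eqv[OF less.prems, of f] by simp
      then show ?thesis using 3 by simp
    qed
  qed
  from this[of "[]" "\<lambda>y. if y = x then 1 else 0"] show ?thesis using pairing_Nil[OF x, of v] by simp
qed

theorem diagonalizable_kernel:
  assumes e: "bij_betw e {..<N} S"
  shows "diagonalizable (kernel_mat N e kernel)"
proof -
  let ?A = "kernel_mat N e kernel"
  have A: "?A \<in> carrier_mat N N" by (simp add: kernel_mat_def)
  define g where "g = inv_into {..<N} e"
  have ge: "g (e i) = i" if "i < N" for i unfolding g_def using that e by (auto simp: bij_betw_def)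
  have eS: "e i \<in> S" if "i < N" for i using bij_betwE[OF e] that by simp
  \<comment> \<open>The field is left open because this serves complex eigenvectors and real Jordan
    chains.\<close>
  have left: "(\<Sum>x\<in>S. v $ g x * of_real (kernel x (e j))) = (map_mat of_real (transpose_mat ?A) *\<^sub>v v) $ j"
    if v: "v \<in> carrier_vec N" and j: "j < N" for v :: "'x :: real_field vec" and j
  proof -
    have "(\<Sum>x\<in>S. v $ g x * of_real (kernel x (e j))) = (\<Sum>i<N. v $ g (e i) * of_real (kernel (e i) (e j)))"
      by (rule sum.reindex_bij_betw[OF e, symmetric])
    also have "\<dots> = (\<Sum>i<N. of_real (kernel (e i) (e j)) * v $ i)"
      by (intro sum.cong) (auto simp: ge mult.commute)
    also have "\<dots> = (map_mat of_real (transpose_mat ?A) *\<^sub>v v) $ j"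
      using v j by (simp add: scalar_prod_def atLeast0LessThan kernel_mat_def)
    finally show ?thesis .
  qed
  have ex: "\<exists>j<N. y = e j" if "y \<in> S" for y using that e by (auto simp: bij_betw_def)
  have "diagonalizable (transpose_mat ?A)"
  proof (rule diagonalizable_if_no_jordan_chain)
    show "transpose_mat ?A \<in> carrier_mat N N" using A by simp
  next
    fix c and v :: "complex vec"
    assume "eigenvector (map_mat complex_of_real (transpose_mat ?A)) v c"
    then have v: "v \<in> carrier_vec N" "v \<noteq> 0\<^sub>v N" "map_mat complex_of_real (transpose_mat ?A) *\<^sub>v v = c \<cdot>\<^sub>v v"
      using A unfolding eigenvector_def by auto
    show "c \<in> \<real>"
    proof (rule ccontr)
      assume c: "c \<notin> \<real>"
      have "v $ g x = 0" if "x \<in> S" for x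
      proof (rule left_eigenvalue_real[OF _ c that, where v = "\<lambda>x. v $ g x"])
        fix y assume "y \<in> S"
        then obtain j where j: "j < N" "y = e j" using ex by blast
        show "(\<Sum>x\<in>S. v $ g x * of_real (kernel x y)) = c * v $ g y"
          unfolding j(2) left[OF v(1) j(1)] v(3) using j(1) v(1) by (simp add: ge)
      qed
      then have "v $ i = 0" if "i < N" for i using eS[OF that] ge[OF that] by metis
      then have "v = 0\<^sub>v N" using v(1) by (intro eq_vecI) auto
      with v(2) show False by simp
    qed
  next
    fix a and u v :: "real vec"
    assume u: "u \<in> carrier_vec N" and v: "v \<in> carrier_vec N"
      and Au: "transpose_mat ?A *\<^sub>v u = a \<cdot>\<^sub>v u + v" and Av: "transpose_mat ?A *\<^sub>v v = a \<cdot>\<^sub>v v"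
    have id: "map_mat of_real (transpose_mat ?A) = transpose_mat ?A" by (intro eq_matI) auto
    have "v $ g x = 0" if "x \<in> S" for x
    proof (rule no_left_jordan_chain[OF _ _ that, where u = "\<lambda>x. u $ g x" and v = "\<lambda>x. v $ g x"])
      fix y assume "y \<in> S"
      then obtain j where j: "j < N" "y = e j" using ex by blast
      show "(\<Sum>x\<in>S. u $ g x * kernel x y) = a * u $ g y + v $ g y"
        using left[OF u j(1), unfolded id Au] j(1) u v by (simp add: ge j(2))
      show "(\<Sum>x\<in>S. v $ g x * kernel x y) = a * v $ g y"
        using left[OF v j(1), unfolded id Av] j(1) v by (simp add: ge j(2))
    qed
    then have "v $ i = 0" if "i < N" for i using eS[OF that] ge[OF that] by metis
    then show "v = 0\<^sub>v N" using v by (intro eq_vecI) auto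
  qed
  then show ?thesis by (rule diagonalizable_transpose[OF A])
qed

text \<open>The left side is the trace of the kernel power composed with the word \<open>g\<close>.
  Letting \<open>g\<close> vary makes the induction work: one step turns \<open>g\<close> into
  \<open>g @ [F]\<close>, which restricts to those \<open>W\<close> with \<open>under F W\<close>,
  and averaging over \<open>F\<close> adds one factor to the power.\<close>

lemma trace_kernel_pow:
  fixes m :: "'l \<Rightarrow> nat" and under :: "'f \<Rightarrow> 'l \<Rightarrow> bool"
  assumes L: "finite L"
    and fixed_points: "\<And>g. set g \<subseteq> T \<Longrightarrow>
      card {x \<in> S. foldr act g x = x} = (\<Sum>W\<in>{W \<in> L. \<forall>G\<in>set g. under G W}. m W)"
    and g: "set g \<subseteq> T"
  shows "(\<Sum>x\<in>S. \<Sum>y\<in>S. kernel_pow S kernel l x y * of_bool (foldr act g y = x)) =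
    (\<Sum>W\<in>{W \<in> L. \<forall>G\<in>set g. under G W}. real (m W) * (\<Sum>F\<in>{F \<in> T. under F W}. pmf w F) ^ l)"
  using g
proof (induction l arbitrary: g)
  case 0
  have "(\<Sum>x\<in>S. \<Sum>y\<in>S. kernel_pow S kernel 0 x y * of_bool (foldr act g y = x)) =
      (\<Sum>x\<in>S. of_bool (foldr act g x = x))"
  proof (intro sum.cong refl)
    fix x assume "x \<in> S"
    have "(\<Sum>y\<in>S. kernel_pow S kernel 0 x y * of_bool (foldr act g y = x)) =
        (\<Sum>y\<in>S. if x = y then of_bool (foldr act g x = x) else 0)"
      by (intro sum.cong) auto
    then show "(\<Sum>y\<in>S. kernel_pow S kernel 0 x y * of_bool (foldr act g y = x)) = of_bool (foldr act g x = x)"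
      using \<open>x \<in> S\<close> finite_S by simp
  qed
  also have "\<dots> = real (card {x \<in> S. foldr act g x = x})"
    using finite_S by (simp add: of_bool_def sum.If_cases Int_def)
  finally show ?case using fixed_points[OF 0] by simp
next
  case (Suc l)
  let ?lam = "\<lambda>W. \<Sum>F\<in>{F \<in> T. under F W}. pmf w F"
  let ?L = "{W \<in> L. \<forall>G\<in>set g. under G W}"
  have "(\<Sum>x\<in>S. \<Sum>y\<in>S. kernel_pow S kernel (Suc l) x y * of_bool (foldr act g y = x)) =
      (\<Sum>x\<in>S. \<Sum>z\<in>S. kernel_pow S kernel l x z * (\<Sum>y\<in>S. kernel z y * of_bool (foldr act g y = x)))"
    by (rule sum.cong[OF refl], simp add: sum_distrib_right sum_distrib_left mult.assoc, rule sum.swap)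
  also have "\<dots> = (\<Sum>x\<in>S. \<Sum>z\<in>S. kernel_pow S kernel l x z * (\<Sum>F\<in>T. pmf w F * of_bool (foldr act g (act F z) = x)))"
    by (intro sum.cong refl) (simp add: sum_kernel_real)
  also have "\<dots> = (\<Sum>x\<in>S. \<Sum>F\<in>T. \<Sum>z\<in>S. pmf w F * (kernel_pow S kernel l x z * of_bool (foldr act (g @ [F]) z = x)))"
    by (intro sum.cong refl, subst sum.swap) (simp add: sum_distrib_left mult_ac)
  also have "\<dots> = (\<Sum>F\<in>T. pmf w F * (\<Sum>x\<in>S. \<Sum>z\<in>S. kernel_pow S kernel l x z * of_bool (foldr act (g @ [F]) z = x)))"
    by (subst sum.swap) (simp add: sum_distrib_left)
  also have "\<dots> = (\<Sum>F\<in>T. pmf w F * (\<Sum>W\<in>{W \<in> L. \<forall>G\<in>set (g @ [F]). under G W}. real (m W) * ?lam W ^ l))"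
    using Suc.prems by (intro sum.cong refl arg_cong2[where f = times] Suc.IH) auto
  also have "\<dots> = (\<Sum>F\<in>T. \<Sum>W\<in>?L. of_bool (under F W) * (pmf w F * (real (m W) * ?lam W ^ l)))"
  proof (intro sum.cong refl)
    fix F
    have "{W \<in> L. \<forall>G\<in>set (g @ [F]). under G W} = {W \<in> ?L. under F W}" by auto
    then show "pmf w F * (\<Sum>W\<in>{W \<in> L. \<forall>G\<in>set (g @ [F]). under G W}. real (m W) * ?lam W ^ l) =
        (\<Sum>W\<in>?L. of_bool (under F W) * (pmf w F * (real (m W) * ?lam W ^ l)))"
      using L by (simp only: sum_distrib_left) (rule sum.mono_neutral_cong_left, auto)
  qed
  also have "\<dots> = (\<Sum>W\<in>?L. real (m W) * ?lam W ^ l * (\<Sum>F\<in>T. of_bool (under F W) * pmf w F))"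
    unfolding sum_distrib_left by (subst sum.swap) (simp add: mult_ac)
  also have "\<dots> = (\<Sum>W\<in>?L. real (m W) * ?lam W ^ Suc l)"
  proof (intro sum.cong refl)
    fix W
    have "(\<Sum>F\<in>T. of_bool (under F W) * pmf w F) = ?lam W"
      using finite_T by (intro sum.mono_neutral_cong_right) auto
    then show "real (m W) * ?lam W ^ l * (\<Sum>F\<in>T. of_bool (under F W) * pmf w F) = real (m W) * ?lam W ^ Suc l"
      by simp
  qed
  finally show ?case .
qed

text \<open>The empty word turns the trace formula into power sums of the spectrum, which determine
  the polynomial of a diagonalizable matrix.\<close>

theorem char_poly_kernel:
  fixes m :: "'l \<Rightarrow> nat" and under :: "'f \<Rightarrow> 'l \<Rightarrow> bool"
  assumes e: "bij_betw e {..<N} S" and L: "finite L"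
    and fixed_points: "\<And>g. set g \<subseteq> T \<Longrightarrow>
      card {x \<in> S. foldr act g x = x} = (\<Sum>W\<in>{W \<in> L. \<forall>G\<in>set g. under G W}. m W)"
  shows "char_poly (kernel_mat N e kernel) = (\<Prod>W\<in>L. [:- (\<Sum>F\<in>{F \<in> T. under F W}. pmf w F), 1:] ^ m W)"
proof (rule char_poly_eq_from_power_sums[OF _ diagonalizable_kernel[OF e] L])
  show "kernel_mat N e kernel \<in> carrier_mat N N" by (simp add: kernel_mat_def)
  fix k
  have "(\<Sum>i<N. (kernel_mat N e kernel ^\<^sub>m k) $$ (i, i)) = (\<Sum>i<N. kernel_pow S kernel k (e i) (e i))"
    by (intro sum.cong refl) (simp add: kernel_mat_pow[OF e])
  also have "\<dots> = (\<Sum>x\<in>S. kernel_pow S kernel k x x)"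
    by (rule sum.reindex_bij_betw[OF e])
  also have "\<dots> = (\<Sum>x\<in>S. \<Sum>y\<in>S. kernel_pow S kernel k x y * of_bool (foldr act [] y = x))"
  proof (intro sum.cong refl)
    fix x assume "x \<in> S"
    have "(\<Sum>y\<in>S. kernel_pow S kernel k x y * of_bool (foldr act [] y = x)) =
        (\<Sum>y\<in>S. if y = x then kernel_pow S kernel k x x else 0)"
      by (intro sum.cong) auto
    then show "kernel_pow S kernel k x x = (\<Sum>y\<in>S. kernel_pow S kernel k x y * of_bool (foldr act [] y = x))"
      using \<open>x \<in> S\<close> finite_S by simp
  qed
  also have "\<dots> = (\<Sum>W\<in>L. real (m W) * (\<Sum>F\<in>{F \<in> T. under F W}. pmf w F) ^ k)"
    by (subst trace_kernel_pow[OF L fixed_points]) auto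
  finally show "(\<Sum>i<N. (kernel_mat N e kernel ^\<^sub>m k) $$ (i, i)) =
      (\<Sum>W\<in>L. real (m W) * (\<Sum>F\<in>{F \<in> T. under F W}. pmf w F) ^ k)" .
qed

section \<open>Laws after finitely many steps, coupling and stationarity\<close>

definition walk_law :: "nat \<Rightarrow> 's \<Rightarrow> 's pmf" where
  "walk_law l x = map_pmf (\<lambda>Fs. foldr act Fs x) (replicate_pmf l w)"

lemma set_walk_law: "x \<in> S \<Longrightarrow> set_pmf (walk_law l x) \<subseteq> S"
  unfolding walk_law_def set_map_pmf set_replicate_pmf
  using set_w by (auto intro!: foldr_closed simp: in_lists_conv_set)

text \<open>\<open>foldr\<close> makes the head of the word the outermost map, hence the last step.
  Reversing independent letters keeps the law, and this order is that of the product of faces in the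
  total variation bound.\<close>

lemma walk_law_Suc: "walk_law (Suc l) x = bind_pmf w (\<lambda>F. map_pmf (act F) (walk_law l x))"
  by (simp add: walk_law_def map_bind_pmf map_pmf_comp comp_def flip: map_pmf_def)

lemma pmf_walk_law:
  assumes x: "x \<in> S"
  shows "y \<in> S \<Longrightarrow> pmf (walk_law l x) y = kernel_pow S kernel l x y"
proof (induction l arbitrary: y)
  case 0
  then show ?case by (simp add: walk_law_def)
next
  case (Suc l)
  have "pmf (map_pmf (act F) (walk_law l x)) y = (\<Sum>z\<in>S. pmf (walk_law l x) z * of_bool (act F z = y))"
    if "F \<in> T" for F
  proof -
    have "pmf (map_pmf (act F) (walk_law l x)) y = measure_pmf.prob (walk_law l x) (act F -` {y})"
      by (rule pmf_map)
    also have "\<dots> = measure_pmf.prob (walk_law l x) {z \<in> S. act F z = y}"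
      using set_walk_law[OF x, of l] by (intro measure_pmf.finite_measure_eq_AE) (auto simp: AE_measure_pmf_iff)
    also have "\<dots> = (\<Sum>z\<in>S. pmf (walk_law l x) z * of_bool (act F z = y))"
      using finite_S by (subst measure_measure_pmf_finite) (auto intro!: sum.mono_neutral_cong_left)
    finally show ?thesis .
  qed
  then have "pmf (walk_law (Suc l) x) y = (\<Sum>F\<in>T. (\<Sum>z\<in>S. pmf (walk_law l x) z * of_bool (act F z = y)) * pmf w F)"
    unfolding walk_law_Suc pmf_bind using finite_T set_w
    by (subst integral_measure_pmf_real[of T]) auto
  also have "\<dots> = (\<Sum>z\<in>S. pmf (walk_law l x) z * (\<Sum>F\<in>T. of_bool (act F z = y) * pmf w F))"
    unfolding sum_distrib_left sum_distrib_right by (subst sum.swap) (simp add: mult_ac)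
  also have "\<dots> = (\<Sum>z\<in>S. kernel_pow S kernel l x z * kernel z y)"
  proof (intro sum.cong refl arg_cong2[where f = times] Suc.IH)
    show "(\<Sum>F\<in>T. of_bool (act F z = y) * pmf w F) = kernel z y" for z
      unfolding kernel_def using finite_T by (intro sum.mono_neutral_cong_right) auto
  qed
  finally show ?case by simp
qed

lemma sum_walk_law:
  assumes x: "x \<in> S" and E: "E \<subseteq> S"
  shows "(\<Sum>y\<in>E. kernel_pow S kernel l x y) = measure_pmf.prob (replicate_pmf l w) {Fs. foldr act Fs x \<in> E}"
proof -
  have "(\<Sum>y\<in>E. kernel_pow S kernel l x y) = (\<Sum>y\<in>E. pmf (walk_law l x) y)"
    using E by (intro sum.cong refl) (auto simp: pmf_walk_law[OF x])
  also have "\<dots> = measure_pmf.prob (walk_law l x) E"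
    using finite_subset[OF E finite_S] by (simp add: measure_measure_pmf_finite)
  also have "\<dots> = measure_pmf.prob (replicate_pmf l w) {Fs. foldr act Fs x \<in> E}"
    by (simp add: walk_law_def vimage_def)
  finally show ?thesis .
qed

lemma stationary_pow:
  assumes p: "stationary S kernel p"
  shows "y \<in> S \<Longrightarrow> (\<Sum>x\<in>S. pmf p x * kernel_pow S kernel l x y) = pmf p y"
proof (induction l arbitrary: y)
  case 0
  have "(\<Sum>x\<in>S. pmf p x * kernel_pow S kernel 0 x y) = (\<Sum>x\<in>S. if x = y then pmf p y else 0)"
    by (intro sum.cong) auto
  then show ?case using 0 finite_S by simp
next
  case (Suc l)
  have "(\<Sum>x\<in>S. pmf p x * kernel_pow S kernel (Suc l) x y) =
      (\<Sum>z\<in>S. (\<Sum>x\<in>S. pmf p x * kernel_pow S kernel l x z) * kernel z y)"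
    by (simp add: sum_distrib_left sum_distrib_right mult.assoc) (rule sum.swap)
  also have "\<dots> = (\<Sum>z\<in>S. pmf p z * kernel z y)" using Suc.IH by simp
  also have "\<dots> = pmf p y" using p Suc.prems by (simp add: stationary_def)
  finally show ?case .
qed

text \<open>Coupling: chains from two starting points driven by the same word meet unless the word is
  one of the words that fail to merge \<open>S\<close> to a point.\<close>

lemma tv_dist_le_prob:
  assumes p: "stationary S kernel p" and D: "D \<in> S"
    and merging: "\<And>Fs x y. set Fs \<subseteq> T \<Longrightarrow> length Fs = l \<Longrightarrow> Fs \<notin> X \<Longrightarrow> x \<in> S \<Longrightarrow> y \<in> S \<Longrightarrow>
      foldr act Fs x = foldr act Fs y"
  shows "tv_dist S (kernel_pow S kernel l D) (pmf p) \<le> measure_pmf.prob (replicate_pmf l w) X"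
proof -
  let ?P = "measure_pmf.prob (replicate_pmf l w)"
  have sum_p: "(\<Sum>x\<in>S. pmf p x) = 1"
    using p by (intro sum_pmf_eq_1 finite_S) (simp add: stationary_def)
  have diff: "?P {Fs. foldr act Fs x \<in> E} \<le> ?P {Fs. foldr act Fs y \<in> E} + ?P X"
    if xy: "x \<in> S" "y \<in> S" for x y E
  proof -
    have sub: "foldr act Fs y \<in> E \<or> Fs \<in> X"
      if "Fs \<in> set_pmf (replicate_pmf l w)" "foldr act Fs x \<in> E" for Fs
    proof (cases "Fs \<in> X")
      case False
      have "set Fs \<subseteq> T" "length Fs = l" using that(1) set_w by (auto simp: set_replicate_pmf in_lists_conv_set)
      from merging[OF this False xy] show ?thesis using that(2) by simp
    qed simp
    have "?P {Fs. foldr act Fs x \<in> E} \<le> ?P ({Fs. foldr act Fs y \<in> E} \<union> X)"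
      using sub by (intro measure_pmf.finite_measure_mono_AE) (auto simp: AE_measure_pmf_iff)
    also have "\<dots> \<le> ?P {Fs. foldr act Fs y \<in> E} + ?P X"
      by (rule measure_Un_le) auto
    finally show ?thesis .
  qed
  have "\<bar>sum (kernel_pow S kernel l D) E - sum (pmf p) E\<bar> \<le> ?P X" if E: "E \<subseteq> S" for E
  proof -
    let ?q = "\<lambda>x. ?P {Fs. foldr act Fs x \<in> E}"
    \<comment> \<open>Stationarity expresses the mass of \<open>E\<close> as an average over
      starting points, so only two starting points have to be compared at a time.\<close>
    have "sum (pmf p) E = (\<Sum>y\<in>E. \<Sum>x\<in>S. pmf p x * kernel_pow S kernel l x y)"
      using E by (intro sum.cong refl) (auto simp: stationary_pow[OF p])
    also have "\<dots> = (\<Sum>x\<in>S. pmf p x * ?q x)"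
      by (subst sum.swap) (simp add: sum_walk_law[OF _ E] flip: sum_distrib_left)
    finally have "sum (kernel_pow S kernel l D) E - sum (pmf p) E = (\<Sum>x\<in>S. pmf p x * ?q D) - (\<Sum>x\<in>S. pmf p x * ?q x)"
      by (simp add: sum_walk_law[OF D E] sum_p flip: sum_distrib_right)
    also have "\<dots> = (\<Sum>x\<in>S. pmf p x * (?q D - ?q x))" by (simp add: sum_subtractf right_diff_distrib)
    finally have "\<bar>sum (kernel_pow S kernel l D) E - sum (pmf p) E\<bar> \<le> (\<Sum>x\<in>S. \<bar>pmf p x * (?q D - ?q x)\<bar>)"
      by (simp only: sum_abs)
    also have "\<dots> \<le> (\<Sum>x\<in>S. pmf p x * ?P X)"
    proof (rule sum_mono)
      fix x assume x: "x \<in> S"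
      have "\<bar>?q D - ?q x\<bar> \<le> ?P X" using diff[OF D x, of E] diff[OF x D, of E] by linarith
      then show "\<bar>pmf p x * (?q D - ?q x)\<bar> \<le> pmf p x * ?P X"
        by (simp add: abs_mult mult_left_mono)
    qed
    also have "\<dots> = ?P X" by (simp add: sum_p flip: sum_distrib_right)
    finally show ?thesis .
  qed
  then show ?thesis unfolding tv_dist_def using finite_S by (subst Max_le_iff) auto
qed

lemma prob_lies: "measure_pmf.prob w {F. lies F H} = (\<Sum>F\<in>{F \<in> T. lies F H}. pmf w F)"
proof -
  have "measure_pmf.prob w {F. lies F H} = measure_pmf.prob w {F \<in> T. lies F H}"
    using set_w by (intro measure_pmf.finite_measure_eq_AE) (auto simp: AE_measure_pmf_iff)
  then show ?thesis using finite_T by (simp add: measure_measure_pmf_finite)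
qed

text \<open>A word merges all states unless some \<open>H\<close> carries all of its letters; the
  union bound and independence give the powers. For \<open>l = 0\<close> the empty word lies on
  every \<open>H\<close>, matching summands equal to one.\<close>

lemma tv_dist_le_sum:
  assumes p: "stationary S kernel p" and D: "D \<in> S"
  shows "tv_dist S (kernel_pow S kernel l D) (pmf p) \<le> (\<Sum>H\<in>B. (\<Sum>F\<in>{F \<in> T. lies F H}. pmf w F) ^ l)"
proof -
  let ?X = "\<Union>H\<in>B. {Fs. \<forall>F\<in>set Fs. lies F H}"
  have "tv_dist S (kernel_pow S kernel l D) (pmf p) \<le> measure_pmf.prob (replicate_pmf l w) ?X"
    by (rule tv_dist_le_prob[OF p D], rule merge) auto
  also have "\<dots> \<le> (\<Sum>H\<in>B. measure_pmf.prob (replicate_pmf l w) {Fs. \<forall>F\<in>set Fs. lies F H})"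
    by (rule measure_UNION_le[OF finite_B]) auto
  finally show ?thesis by (simp only: prob_replicate_pmf_all prob_lies)
qed

text \<open>No mass leaves \<open>R\<close>, so a stationary distribution of the restricted chain
  extends by zero. This yields existence for \<open>R = S\<close>, and nonuniqueness from two
  disjoint choices of \<open>R\<close>.\<close>

lemma closed_subset_stationary:
  assumes R: "R \<subseteq> S" "R \<noteq> {}" and closed: "\<And>F x. F \<in> set_pmf w \<Longrightarrow> x \<in> R \<Longrightarrow> act F x \<in> R"
  shows "\<exists>p. stationary S kernel p \<and> set_pmf p \<subseteq> R"
proof -
  have zero: "kernel x y = 0" if "x \<in> R" "y \<notin> R" for x y
    unfolding kernel_def using closed[OF _ that(1)] that(2)
    by (intro sum.neutral) (auto simp: set_pmf_iff)
  have finR: "finite R" using finite_subset[OF R(1) finite_S] .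
  have "\<exists>p. stationary R kernel p"
  proof (rule stationary_exists[OF finR R(2)])
    show "kernel x y \<ge> 0" for x y unfolding kernel_def by (intro sum_nonneg) auto
    fix x assume x: "x \<in> R"
    have "(\<Sum>y\<in>R. kernel x y) = (\<Sum>y\<in>S. kernel x y)"
      using R finite_S zero[OF x] by (intro sum.mono_neutral_left) auto
    also have "\<dots> = 1" using sum_kernel_real[of x "\<lambda>_. 1"] x R sum_w by auto
    finally show "(\<Sum>y\<in>R. kernel x y) = 1" .
  qed
  then obtain p where p: "stationary R kernel p" ..
  then have setp: "set_pmf p \<subseteq> R" by (simp add: stationary_def)
  have "(\<Sum>x\<in>S. pmf p x * kernel x y) = pmf p y" if y: "y \<in> S" for y
  proof -
    have eq: "(\<Sum>x\<in>S. pmf p x * kernel x y) = (\<Sum>x\<in>R. pmf p x * kernel x y)"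
      using R finite_S setp by (intro sum.mono_neutral_right) (auto simp: set_pmf_iff)
    show ?thesis
    proof (cases "y \<in> R")
      case True
      then show ?thesis using p eq by (simp add: stationary_def)
    next
      case False
      then have "pmf p y = 0" using setp by (auto simp: set_pmf_iff)
      then show ?thesis unfolding eq using zero False by simp
    qed
  qed
  then show ?thesis using setp R unfolding stationary_def by blast
qed

text \<open>Some letter of positive weight is off each \<open>H\<close>, so the bases in
  \<open>tv_dist_le_sum\<close> are below one, and any stationary distribution is the limit of the
  same sequence.\<close>

theorem ex1_stationary:
  assumes sep: "\<And>H. H \<in> B \<Longrightarrow> \<exists>F\<in>T. \<not> lies F H \<and> pmf w F > 0"
  shows "\<exists>!p. stationary S kernel p"
proof -
  let ?lam = "\<lambda>H. \<Sum>F\<in>{F \<in> T. lies F H}. pmf w F"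
  have lam: "0 \<le> ?lam H" "?lam H < 1" if H: "H \<in> B" for H
  proof -
    show "0 \<le> ?lam H" by (intro sum_nonneg) auto
    obtain F where F: "F \<in> T" "\<not> lies F H" "pmf w F > 0" using sep[OF H] by blast
    have "?lam H < pmf w F + ?lam H" using F by simp
    also have "\<dots> = (\<Sum>F\<in>insert F {F \<in> T. lies F H}. pmf w F)" using F finite_T by simp
    also have "\<dots> \<le> (\<Sum>F\<in>T. pmf w F)" using F finite_T by (intro sum_mono2) auto
    finally show "?lam H < 1" using sum_w by simp
  qed
  have tends: "(\<lambda>l. \<Sum>H\<in>B. ?lam H ^ l) \<longlonglongrightarrow> 0"
  proof -
    have "(\<lambda>l. \<Sum>H\<in>B. ?lam H ^ l) \<longlonglongrightarrow> (\<Sum>H\<in>B. 0)"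
      using lam by (intro tendsto_sum LIMSEQ_power_zero) auto
    then show ?thesis by simp
  qed
  obtain D where D: "D \<in> S" using S_nonempty by blast
  have limit: "(\<lambda>l. kernel_pow S kernel l D y) \<longlonglongrightarrow> pmf p y" if p: "stationary S kernel p" and y: "y \<in> S" for p y
  proof -
    have "norm (kernel_pow S kernel l D y - pmf p y) \<le> (\<Sum>H\<in>B. ?lam H ^ l)" for l
    proof -
      have "\<bar>sum (kernel_pow S kernel l D) {y} - sum (pmf p) {y}\<bar> \<le> tv_dist S (kernel_pow S kernel l D) (pmf p)"
        unfolding tv_dist_def using finite_S y by (intro Max_ge imageI) auto
      then show ?thesis using tv_dist_le_sum[OF p D, of l] by simp
    qed
    then have "(\<lambda>l. kernel_pow S kernel l D y - pmf p y) \<longlonglongrightarrow> 0"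
      using tends by (intro Lim_null_comparison[OF _ tends]) auto
    then show ?thesis by (simp add: LIM_zero_iff)
  qed
  show ?thesis
  proof (rule ex_ex1I)
    show "\<exists>p. stationary S kernel p"
      using closed_subset_stationary[OF order_refl S_nonempty] act_closed set_w by blast
    fix p q assume p: "stationary S kernel p" and q: "stationary S kernel q"
    show "p = q"
    proof (rule pmf_eqI)
      fix y
      show "pmf p y = pmf q y"
      proof (cases "y \<in> S")
        case True
        then show ?thesis using LIMSEQ_unique[OF limit[OF p] limit[OF q]] by blast
      next
        case False
        then have "pmf p y = 0" "pmf q y = 0" using p q by (auto simp: stationary_def set_pmf_iff)
        then show ?thesis by simp
      qed
    qed
  qed
qed

end

section \<open>The walk on the chambers of a subarrangement\<close>

locale subarrangement =
  fixes A B :: "(real ^ 'n) set set"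
  assumes arrangement: "arrangement A" and subset: "B \<subseteq> A"
begin

lemma arrangement_B: "arrangement B"
  by (rule arrangement_subset[OF arrangement subset])

lemma lies_iff: "F \<in> faces A \<Longrightarrow> H \<in> B \<Longrightarrow> face_side F H = 0 \<longleftrightarrow> F \<subseteq> H"
  using face_side_eq_0_iff[OF arrangement] subset by blast

lemmas act_chamber = face_act_chamber(1)[OF arrangement subset]
lemmas act_side = face_act_chamber(2)[OF arrangement subset]
lemmas chamber_eq = chamber_eqI[OF arrangement_B]

lemma word_chamber:
  "set g \<subseteq> faces A \<Longrightarrow> D \<in> chambers B \<Longrightarrow> foldr (face_act B) g D \<in> chambers B"
  by (induction g) (auto intro: act_chamber)

lemma word_side_inside:
  assumes "set g \<subseteq> faces A" "D \<in> chambers B" "H \<in> B" "\<And>G. G \<in> set g \<Longrightarrow> G \<subseteq> H"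
  shows "face_side (foldr (face_act B) g D) H = face_side D H"
  using assms
proof (induction g)
  case (Cons F g)
  then have "face_side F H = 0" "foldr (face_act B) g D \<in> chambers B"
    using lies_iff word_chamber by auto
  with Cons show ?case by (simp add: act_side)
qed simp

text \<open>The outermost letter not inside \<open>H\<close> decides the side, whatever chamber it
  acts on.\<close>

lemma word_side_outside:
  assumes "set g \<subseteq> faces A" "D \<in> chambers B" "D' \<in> chambers B" "H \<in> B" "\<exists>G\<in>set g. \<not> G \<subseteq> H"
  shows "face_side (foldr (face_act B) g D) H = face_side (foldr (face_act B) g D') H"
  using assms
proof (induction g)
  case (Cons F g)
  have w: "foldr (face_act B) g D \<in> chambers B" "foldr (face_act B) g D' \<in> chambers B" and F: "F \<in> faces A"
    using Cons.prems word_chamber by auto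
  show ?case
  proof (cases "F \<subseteq> H")
    case True
    then have "\<exists>G\<in>set g. \<not> G \<subseteq> H" using Cons.prems by auto
    then show ?thesis using Cons F w by (simp add: act_side)
  next
    case False
    then have "face_side F H \<noteq> 0" using lies_iff[OF F] Cons.prems by simp
    then show ?thesis using F w Cons.prems by (simp add: act_side)
  qed
qed simp

text \<open>Signs are compared on one hyperplane at a time. A letter off the hyperplane decides the
  side; for absorption, a hyperplane containing all letters also contains \<open>F\<close>, which
  then changes nothing there.\<close>

lemma absorbing_walk:
  assumes w: "set_pmf w \<subseteq> faces A"
  shows "absorbing_walk (chambers B) (faces A) w (face_act B) B (\<subseteq>)"
proof
  show "finite (chambers B)"
    using finite_subset[OF chambers_subset_faces finite_faces] arrangement_B by blast
  show "finite (faces A)" by (rule finite_faces[OF arrangement])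
  show "finite B" by (rule arrangementD(1)[OF arrangement_B])
  show "chambers B \<noteq> {}" by (rule chambers_nonempty[OF arrangement_B])
  show "set_pmf w \<subseteq> faces A" by (rule w)
  show "face_act B F D \<in> chambers B" if "F \<in> faces A" "D \<in> chambers B" for F D
    using that by (rule act_chamber)
next
  fix g F D assume g: "set g \<subseteq> faces A" and F: "F \<in> faces A" and D: "D \<in> chambers B"
    and H: "\<And>H. H \<in> B \<Longrightarrow> (\<And>G. G \<in> set g \<Longrightarrow> G \<subseteq> H) \<Longrightarrow> F \<subseteq> H"
  have FD: "face_act B F D \<in> chambers B" by (rule act_chamber[OF F D])
  show "foldr (face_act B) g (face_act B F D) = foldr (face_act B) g D"
  proof (rule chamber_eq[OF word_chamber[OF g FD] word_chamber[OF g D]])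
    fix K assume K: "K \<in> B"
    show "face_side (foldr (face_act B) g (face_act B F D)) K = face_side (foldr (face_act B) g D) K"
    proof (cases "\<exists>G\<in>set g. \<not> G \<subseteq> K")
      case True
      show ?thesis by (rule word_side_outside[OF g FD D K True])
    next
      case False
      then have in_K: "G \<subseteq> K" if "G \<in> set g" for G using that by blast
      have "F \<subseteq> K" using K in_K by (rule H)
      then have "face_side F K = 0" using lies_iff[OF F K] by simp
      then have "face_side (face_act B F D) K = face_side D K" unfolding act_side[OF F D K] by simp
      moreover have "face_side (foldr (face_act B) g C) K = face_side C K" if "C \<in> chambers B" for C
        using g that K in_K by (rule word_side_inside)
      ultimately show ?thesis using FD D by simp
    qed
  qed
next
  fix g D D' assume g: "set g \<subseteq> faces A" and D: "D \<in> chambers B" and D': "D' \<in> chambers B"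
    and H: "\<And>H. H \<in> B \<Longrightarrow> \<exists>G\<in>set g. \<not> G \<subseteq> H"
  show "foldr (face_act B) g D = foldr (face_act B) g D'"
    by (rule chamber_eq[OF word_chamber[OF g D] word_chamber[OF g D']])
      (rule word_side_outside[OF g D D' _ H])
qed

text \<open>A word prescribes the side on each hyperplane that does not contain all of its letters
  and leaves the others alone, so a fixed chamber is determined by its chamber in the
  localization.\<close>

lemma card_fixed_chambers:
  assumes g: "set g \<subseteq> faces A"
  shows "card {D \<in> chambers B. foldr (face_act B) g D = D} = card (chambers {H \<in> B. \<forall>G\<in>set g. G \<subseteq> H})"
proof (rule bij_betw_same_card)
  let ?B = "{H \<in> B. \<forall>G\<in>set g. G \<subseteq> H}"
  let ?act = "foldr (face_act B) g"
  have sub: "?B \<subseteq> B" by blast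
  have B0: "arrangement ?B" by (rule arrangement_subset[OF arrangement_B sub])
  note cc = chamber_containing_cell[OF arrangement_B sub]
  show "bij_betw (chamber_containing ?B) {D \<in> chambers B. ?act D = D} (chambers ?B)"
  proof (rule bij_betw_imageI)
    show "inj_on (chamber_containing ?B) {D \<in> chambers B. ?act D = D}"
    proof (rule inj_onI)
      fix D D' assume "D \<in> {D \<in> chambers B. ?act D = D}" "D' \<in> {D \<in> chambers B. ?act D = D}"
        and eq: "chamber_containing ?B D = chamber_containing ?B D'"
      then have D: "D \<in> chambers B" "?act D = D" and D': "D' \<in> chambers B" "?act D' = D'" by auto
      show "D = D'"
      proof (rule chamber_eq[OF D(1) D'(1)])
        fix H assume H: "H \<in> B"
        show "face_side D H = face_side D' H"
        proof (cases "\<exists>G\<in>set g. \<not> G \<subseteq> H")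
          case True
          from word_side_outside[OF g D(1) D'(1) H True] show ?thesis unfolding D(2) D'(2) .
        next
          case False
          with H have "H \<in> ?B" by blast
          from cc(4)[OF D(1) this] cc(4)[OF D'(1) this] show ?thesis unfolding eq by simp
        qed
      qed
    qed
    show "chamber_containing ?B ` {D \<in> chambers B. ?act D = D} = chambers ?B"
    proof
      show "chamber_containing ?B ` {D \<in> chambers B. ?act D = D} \<subseteq> chambers ?B"
        using cc(1) by blast
      show "chambers ?B \<subseteq> chamber_containing ?B ` {D \<in> chambers B. ?act D = D}"
      proof
        fix E assume E: "E \<in> chambers ?B"
        obtain C where C: "C \<in> chambers B" "chamber_containing ?B C = E"
          using chamber_containing_surj[OF arrangement_B sub E] by blast
        \<comment> \<open>Words act idempotently, so applying the word to any lift of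
          \<open>E\<close> gives a fixed chamber.\<close>
        let ?D = "?act C"
        have D: "?D \<in> chambers B" by (rule word_chamber[OF g C(1)])
        have "?act ?D = ?D"
        proof (rule chamber_eq[OF word_chamber[OF g D] D])
          fix H assume H: "H \<in> B"
          show "face_side (?act ?D) H = face_side ?D H"
          proof (cases "\<exists>G\<in>set g. \<not> G \<subseteq> H")
            case True
            show ?thesis by (rule word_side_outside[OF g D C(1) H True])
          next
            case False
            then show ?thesis by (intro word_side_inside[OF g D H]) blast
          qed
        qed
        moreover have "chamber_containing ?B ?D = E"
        proof (rule chamber_eqI[OF B0 cc(1)[OF D] E])
          fix H assume H: "H \<in> ?B"
          have "face_side ?D H = face_side C H"
            by (rule word_side_inside[OF g C(1)]) (use H in auto)
          then show "face_side (chamber_containing ?B ?D) H = face_side E H"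
            using cc(4)[OF D H] cc(4)[OF C(1) H] C(2) by simp
        qed
        ultimately show "E \<in> chamber_containing ?B ` {D \<in> chambers B. ?act D = D}"
          using D by (intro image_eqI[of _ _ ?D]) auto
      qed
    qed
  qed
qed

lemma fixed_chambers_moebius:
  assumes "set g \<subseteq> faces A"
  shows "card {D \<in> chambers B. foldr (face_act B) g D = D} =
    (\<Sum>W\<in>{W \<in> intersection_poset B. \<forall>G\<in>set g. G \<subseteq> W}. nat \<bar>poset_moebius (intersection_poset B) UNIV W\<bar>)"
proof -
  have "int (card {D \<in> chambers B. foldr (face_act B) g D = D}) =
      (\<Sum>W\<in>{W \<in> intersection_poset B. \<forall>G\<in>set g. G \<subseteq> W}. \<bar>poset_moebius (intersection_poset B) UNIV W\<bar>)"
    unfolding card_fixed_chambers[OF assms] by (rule card_chambers_localization[OF arrangement_B])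
  also have "\<dots> = int (\<Sum>W\<in>{W \<in> intersection_poset B. \<forall>G\<in>set g. G \<subseteq> W}. nat \<bar>poset_moebius (intersection_poset B) UNIV W\<bar>)"
    by simp
  finally show ?thesis by (simp only: of_nat_eq_iff)
qed

text \<open>Both sides compose the same signs on \<open>B\<close>. This compatibility makes the
  induced process a Markov chain.\<close>

lemma chamber_containing_act:
  assumes F: "F \<in> faces A" and C: "C \<in> chambers A"
  shows "chamber_containing B (face_act A F C) = face_act B F (chamber_containing B C)"
proof -
  note cc = chamber_containing_cell[OF arrangement subset]
  have FC: "face_act A F C \<in> chambers A" by (rule face_act_chamber(1)[OF arrangement order_refl F C])
  show ?thesis
  proof (rule chamber_eq[OF cc(1)[OF FC] act_chamber[OF F cc(1)[OF C]]])
    fix H assume H: "H \<in> B"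
    then have "H \<in> A" using subset by blast
    then show "face_side (chamber_containing B (face_act A F C)) H = face_side (face_act B F (chamber_containing B C)) H"
      unfolding cc(4)[OF FC H] act_side[OF F cc(1)[OF C] H] cc(4)[OF C H]
      by (rule face_act_chamber(2)[OF arrangement order_refl F C])
  qed
qed

lemma chamber_subset_iff:
  assumes "C \<in> chambers A" "D \<in> chambers B"
  shows "C \<subseteq> D \<longleftrightarrow> chamber_containing B C = D"
  using chamber_containing_cell(2,3)[OF arrangement subset assms(1)] assms(2) by blast

lemma chamber_on_side:
  assumes H: "H \<in> B" and s: "s = 1 \<or> s = - 1"
  shows "\<exists>D\<in>chambers B. face_side D H = s"
proof -
  have HA: "H \<in> A" using H subset by blast
  obtain p where p: "side H p = s" using side_attained[OF arrangementD(2)[OF arrangement HA] s] by blast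
  obtain D where D: "D \<in> chambers B" using chambers_nonempty[OF arrangement_B] by blast
  have F: "cell A p \<in> faces A" using arrangement_faces[OF arrangement] by auto
  have "s \<noteq> 0" using s by auto
  then have "face_side (face_act B (cell A p) D) H = s"
    unfolding act_side[OF F D H] face_side_cell[OF HA] p by simp
  then show ?thesis using act_chamber[OF F D] by blast
qed

text \<open>Composing zero signs gives zero. By contraposition, a product outside the union of
  \<open>B\<close> has a letter off each \<open>H\<close>, and such words merge all
  chambers.\<close>

lemma face_prod_list_inside:
  assumes H: "H \<in> A" and Fs: "set Fs \<subseteq> faces A" "Fs \<noteq> []" "\<And>F. F \<in> set Fs \<Longrightarrow> F \<subseteq> H"
  shows "face_prod_list A Fs \<subseteq> H"
proof -
  have "foldl (face_prod A) P Gs \<subseteq> H"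
    if "P \<in> faces A" "P \<subseteq> H" "set Gs \<subseteq> faces A" "\<And>G. G \<in> set Gs \<Longrightarrow> G \<subseteq> H" for P Gs
    using that
  proof (induction Gs arbitrary: P)
    case (Cons G Gs)
    have PG: "P \<in> faces A" "G \<in> faces A" using Cons.prems by auto
    have "face_side P H = 0" "face_side G H = 0"
      using face_side_eq_0_iff[OF arrangement _ H] PG Cons.prems by auto
    then have "face_side (face_prod A P G) H = 0" using face_prod_in_faces(2)[OF arrangement PG H] by simp
    then have "face_prod A P G \<subseteq> H"
      using face_side_eq_0_iff[OF arrangement face_prod_in_faces(1)[OF arrangement PG] H] by simp
    then show ?case
      using Cons.IH[OF face_prod_in_faces(1)[OF arrangement PG]] Cons.prems by simp
  qed simp
  then show ?thesis using Fs unfolding face_prod_list_def by (cases Fs) auto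
qed

end

locale subarrangement_walk = subarrangement +
  fixes w :: "(real ^ 'a) set pmf"
  assumes w: "set_pmf w \<subseteq> faces A"

sublocale subarrangement_walk \<subseteq> walk: absorbing_walk "chambers B" "faces A" w "face_act B" B "(\<subseteq>)"
  by (rule absorbing_walk[OF w])

context subarrangement_walk
begin

text \<open>The probability of entering a fibre depends on \<open>C\<close> only through its chamber
  in \<open>B\<close>, so the choice in \<open>induced_kernel\<close> is immaterial.\<close>

lemma lumping:
  assumes C: "C \<in> chambers A"
  shows "(\<Sum>C'\<in>{C' \<in> chambers A. chamber_containing B C' = D'}. walk_kernel A w C C') =
    walk.kernel (chamber_containing B C) D'"
proof -
  have fin: "finite (chambers A)"
    using finite_subset[OF chambers_subset_faces finite_faces] arrangement by blast
  have act: "face_prod A F C = face_act A F C" "face_act A F C \<in> chambers A" if "F \<in> faces A" for F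
    using face_prod_chamber[OF arrangement that C] face_act_chamber(1)[OF arrangement order_refl that C] by simp_all
  let ?Fs = "{F \<in> faces A. face_act B F (chamber_containing B C) = D'}"
  have "walk.kernel (chamber_containing B C) D' = (\<Sum>F\<in>?Fs. pmf w F)"
    by (simp add: walk.kernel_def)
  also have "\<dots> = (\<Sum>C'\<in>{C' \<in> chambers A. chamber_containing B C' = D'}. \<Sum>F\<in>{F \<in> ?Fs. face_prod A F C = C'}. pmf w F)"
    by (rule sum.group[symmetric])
      (use fin finite_faces[OF arrangement] act chamber_containing_act[OF _ C] in auto)
  also have "\<dots> = (\<Sum>C'\<in>{C' \<in> chambers A. chamber_containing B C' = D'}. walk_kernel A w C C')"
    unfolding walk_kernel_def
    by (intro sum.cong refl) (use act chamber_containing_act[OF _ C] in auto)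
  finally show ?thesis by simp
qed

lemma induced_kernel_eq:
  assumes "D \<in> chambers B"
  shows "induced_kernel A B w D D' = walk.kernel D D'"
proof -
  let ?C = "SOME C. C \<in> chambers A \<and> chamber_containing B C = D"
  have "?C \<in> chambers A \<and> chamber_containing B ?C = D"
    by (rule someI_ex) (use chamber_containing_surj[OF arrangement subset assms] in blast)
  then show ?thesis unfolding induced_kernel_def Let_def using lumping[of ?C D'] by simp
qed

lemma kernel_mat_induced:
  assumes "bij_betw e {..<N} (chambers B)"
  shows "kernel_mat N e (induced_kernel A B w) = kernel_mat N e walk.kernel"
  unfolding kernel_mat_def
  by (intro cong_mat refl) (use bij_betwE[OF assms] in \<open>auto simp: induced_kernel_eq\<close>)

lemma stationary_induced: "stationary (chambers B) (induced_kernel A B w) = stationary (chambers B) walk.kernel"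
  unfolding stationary_def by (intro ext) (simp add: induced_kernel_eq cong: sum.cong)

lemma kernel_pow_induced:
  "kernel_pow (chambers B) (induced_kernel A B w) l D = kernel_pow (chambers B) walk.kernel l D"
  by (induction l) (auto simp: induced_kernel_eq fun_eq_iff cong: sum.cong)

lemma stationary_pushforward:
  assumes p: "stationary (chambers A) (walk_kernel A w) p"
  shows "stationary (chambers B) walk.kernel (map_pmf (chamber_containing B) p)"
    and "D \<in> chambers B \<Longrightarrow> pmf (map_pmf (chamber_containing B) p) D = (\<Sum>C\<in>{C \<in> chambers A. C \<subseteq> D}. pmf p C)"
proof -
  let ?c = "chamber_containing B"
  note cc = chamber_containing_cell[OF arrangement subset]
  have fin: "finite (chambers A)" "finite (chambers B)"
    using finite_subset[OF chambers_subset_faces finite_faces] arrangement arrangement_B by blast+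
  have supp: "set_pmf p \<subseteq> chambers A" using p by (simp add: stationary_def)
  have pmf_c: "pmf (map_pmf ?c p) D = (\<Sum>C\<in>{C \<in> chambers A. ?c C = D}. pmf p C)" for D
  proof -
    have "pmf (map_pmf ?c p) D = measure_pmf.prob p {C \<in> chambers A. ?c C = D}"
      unfolding pmf_map using supp by (intro measure_pmf.finite_measure_eq_AE) (auto simp: AE_measure_pmf_iff)
    then show ?thesis using fin by (simp add: measure_measure_pmf_finite)
  qed
  show "stationary (chambers B) walk.kernel (map_pmf ?c p)"
    unfolding stationary_def
  proof (intro conjI ballI)
    show "set_pmf (map_pmf ?c p) \<subseteq> chambers B" using supp cc(1) by auto
    fix D' assume "D' \<in> chambers B"
    have "(\<Sum>D\<in>chambers B. pmf (map_pmf ?c p) D * walk.kernel D D') =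
        (\<Sum>D\<in>chambers B. \<Sum>C\<in>{C \<in> chambers A. ?c C = D}. pmf p C * walk.kernel (?c C) D')"
      unfolding pmf_c sum_distrib_right by (intro sum.cong refl) auto
    also have "\<dots> = (\<Sum>C\<in>chambers A. pmf p C * walk.kernel (?c C) D')"
      by (rule sum.group) (use fin cc(1) in auto)
    also have "\<dots> = (\<Sum>C\<in>chambers A. \<Sum>C'\<in>{C' \<in> chambers A. ?c C' = D'}. pmf p C * walk_kernel A w C C')"
      by (intro sum.cong refl) (simp add: lumping[symmetric] sum_distrib_left)
    also have "\<dots> = (\<Sum>C'\<in>{C' \<in> chambers A. ?c C' = D'}. \<Sum>C\<in>chambers A. pmf p C * walk_kernel A w C C')"
      by (rule sum.swap)
    also have "\<dots> = (\<Sum>C'\<in>{C' \<in> chambers A. ?c C' = D'}. pmf p C')"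
      using p by (intro sum.cong refl) (auto simp: stationary_def)
    finally show "(\<Sum>D\<in>chambers B. pmf (map_pmf ?c p) D * walk.kernel D D') = pmf (map_pmf ?c p) D'"
      unfolding pmf_c .
  qed
  show "pmf (map_pmf ?c p) D = (\<Sum>C\<in>{C \<in> chambers A. C \<subseteq> D}. pmf p C)" if D: "D \<in> chambers B"
    unfolding pmf_c by (intro sum.cong refl) (use chamber_subset_iff D in auto)
qed

text \<open>If all faces of positive weight lie in \<open>H\<close>, no step changes the side of
  \<open>H\<close>, and each side carries a stationary distribution of its own.\<close>

lemma ex1_stationary_iff:
  "(\<exists>!p. stationary (chambers B) walk.kernel p) \<longleftrightarrow> (\<forall>H\<in>B. \<exists>F\<in>faces A. \<not> F \<subseteq> H \<and> pmf w F > 0)"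
proof
  assume "\<forall>H\<in>B. \<exists>F\<in>faces A. \<not> F \<subseteq> H \<and> pmf w F > 0"
  then show "\<exists>!p. stationary (chambers B) walk.kernel p" by (intro walk.ex1_stationary) blast
next
  assume unique: "\<exists>!p. stationary (chambers B) walk.kernel p"
  show "\<forall>H\<in>B. \<exists>F\<in>faces A. \<not> F \<subseteq> H \<and> pmf w F > 0"
  proof (rule ccontr)
    assume "\<not> ?thesis"
    then obtain H where H: "H \<in> B" and in_H: "\<And>F. F \<in> faces A \<Longrightarrow> pmf w F > 0 \<Longrightarrow> F \<subseteq> H" by blast
    have "\<exists>p. stationary (chambers B) walk.kernel p \<and> set_pmf p \<subseteq> {D \<in> chambers B. face_side D H = s}"
      if s: "s = 1 \<or> s = - 1" for s
    proof (rule walk.closed_subset_stationary)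
      show "{D \<in> chambers B. face_side D H = s} \<noteq> {}" using chamber_on_side[OF H s] by blast
      fix F D assume Fw: "F \<in> set_pmf w" and D: "D \<in> {D \<in> chambers B. face_side D H = s}"
      from Fw have F: "F \<in> faces A" using w by blast
      have "pmf w F > 0" using Fw by (rule pmf_positive)
      then have "F \<subseteq> H" using in_H[OF F] by blast
      then have "face_side F H = 0" using lies_iff[OF F H] by simp
      then show "face_act B F D \<in> {D \<in> chambers B. face_side D H = s}"
        using D act_chamber[OF F] act_side[OF F _ H] by simp
    qed blast
    from this[of 1] this[of "- 1"] obtain p q
      where p: "stationary (chambers B) walk.kernel p" "set_pmf p \<subseteq> {D \<in> chambers B. face_side D H = 1}"
        and q: "stationary (chambers B) walk.kernel q" "set_pmf q \<subseteq> {D \<in> chambers B. face_side D H = - 1}"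
      by auto
    have "p = q" using unique p(1) q(1) by blast
    moreover obtain D where "D \<in> set_pmf p" using set_pmf_not_empty[of p] by blast
    ultimately have "face_side D H = 1" "face_side D H = - 1" using p(2) q(2) by blast+
    then show False by simp
  qed
qed

text \<open>The condition \<open>l \<ge> 1\<close> keeps the word nonempty, so that
  \<open>face_prod_list\<close> is a genuine product.\<close>

lemma tv_dist_le_prob_face_prod:
  assumes p: "stationary (chambers B) walk.kernel p" and D: "D \<in> chambers B" and l: "l \<ge> 1"
  shows "tv_dist (chambers B) (kernel_pow (chambers B) walk.kernel l D) (pmf p)
    \<le> measure_pmf.prob (replicate_pmf l w) {Fs. face_prod_list A Fs \<subseteq> \<Union>B}"
proof (rule walk.tv_dist_le_prob[OF p D])
  fix Fs C C' assume Fs: "set Fs \<subseteq> faces A" "length Fs = l" "Fs \<notin> {Fs. face_prod_list A Fs \<subseteq> \<Union>B}"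
    and C: "C \<in> chambers B" "C' \<in> chambers B"
  show "foldr (face_act B) Fs C = foldr (face_act B) Fs C'"
  proof (rule walk.merge[OF Fs(1) C], rule ccontr)
    fix H assume H: "H \<in> B" and "\<not> (\<exists>G\<in>set Fs. \<not> G \<subseteq> H)"
    then have "face_prod_list A Fs \<subseteq> H"
      using Fs(1,2) l subset by (intro face_prod_list_inside) auto
    then show False using Fs(3) H by blast
  qed
qed

end

theorem theorem3p3:
  fixes A B :: "(real ^ 'n) set set" and w :: "(real ^ 'n) set pmf"
  assumes arr: "arrangement A"
    and w: "set_pmf w \<subseteq> faces A"
    and sub: "B \<subseteq> A"
  defines "K \<equiv> walk_kernel A w"
    and "Ks \<equiv> induced_kernel A B w"
    and "N \<equiv> card (chambers B)"
    and "L \<equiv> intersection_poset B"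
  shows
    "(\<forall>e. bij_betw e {..<N} (chambers B) \<longrightarrow>
        char_poly (kernel_mat N e Ks) =
          (\<Prod>W\<in>L. [:- face_mass A w W, 1:] ^ nat \<bar>poset_moebius L UNIV W\<bar>)) \<and>
     (\<forall>W\<in>L. \<bar>poset_moebius L UNIV W\<bar> = (- 1) ^ codim W * poset_moebius L UNIV W) \<and>
     (\<forall>e. bij_betw e {..<N} (chambers B) \<longrightarrow> diagonalizable (kernel_mat N e Ks)) \<and>
     ((\<exists>!p. stationary (chambers B) Ks p) \<longleftrightarrow>
        (\<forall>H\<in>B. \<exists>F\<in>faces A. \<not> F \<subseteq> H \<and> pmf w F > 0)) \<and>
     (separating A w \<longrightarrow>
        (\<exists>!p. stationary (chambers A) K p) \<and>
        (\<forall>p pbar. stationary (chambers A) K p \<and> stationary (chambers B) Ks pbar \<longrightarrow>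
           (\<forall>D\<in>chambers B. pmf pbar D = (\<Sum>C\<in>{C \<in> chambers A. C \<subseteq> D}. pmf p C)))) \<and>
     (\<forall>pbar. (\<exists>!p. stationary (chambers B) Ks p) \<and> stationary (chambers B) Ks pbar \<longrightarrow>
        (\<forall>D\<in>chambers B. \<forall>l.
           (l \<ge> 1 \<longrightarrow>
              tv_dist (chambers B) (kernel_pow (chambers B) Ks l D) (pmf pbar)
                \<le> measure_pmf.prob (replicate_pmf l w) {Fs. face_prod_list A Fs \<subseteq> \<Union>B}) \<and>
           tv_dist (chambers B) (kernel_pow (chambers B) Ks l D) (pmf pbar)
             \<le> (\<Sum>H\<in>B. face_mass A w H ^ l)))"
proof -
  interpret B: subarrangement_walk A B w by unfold_locales (rule arr, rule sub, rule w)
  \<comment> \<open>The original walk is the case \<open>B = A\<close>, where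
    \<open>face_act A\<close> agrees with the face product on chambers.\<close>
  interpret A: subarrangement_walk A A w by unfold_locales (rule arr, rule order_refl, rule w)
  have K: "stationary (chambers A) K = stationary (chambers A) A.walk.kernel"
    unfolding K_def stationary_def
    by (intro ext)
      (simp add: walk_kernel_def A.walk.kernel_def face_prod_chamber[OF arr] cong: sum.cong conj_cong)
  note Ks = B.stationary_induced[folded Ks_def] and Ks_pow = B.kernel_pow_induced[folded Ks_def]
  have mass: "face_mass A w W = (\<Sum>F\<in>{F \<in> faces A. F \<subseteq> W}. pmf w F)" for W
    by (simp add: face_mass_def)
  have sep_A: "\<exists>!p. stationary (chambers A) K p" if "separating A w"
    unfolding K using that unfolding separating_def by (rule A.ex1_stationary_iff[THEN iffD2])
  have sep_B: "\<exists>!p. stationary (chambers B) Ks p" if s: "separating A w"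
    unfolding Ks
  proof (rule B.ex1_stationary_iff[THEN iffD2], rule ballI)
    show "\<exists>F\<in>faces A. \<not> F \<subseteq> H \<and> pmf w F > 0" if "H \<in> B" for H
      using s subsetD[OF sub that] unfolding separating_def by (rule bspec)
  qed
  show ?thesis
  proof (intro conjI allI impI ballI)
    fix e assume e: "bij_betw e {..<N} (chambers B)"
    show "char_poly (kernel_mat N e Ks) = (\<Prod>W\<in>L. [:- face_mass A w W, 1:] ^ nat \<bar>poset_moebius L UNIV W\<bar>)"
      unfolding Ks_def B.kernel_mat_induced[OF e] mass L_def
      by (rule B.walk.char_poly_kernel[OF e finite_intersection_poset[OF B.arrangement_B]
            B.fixed_chambers_moebius])
    show "diagonalizable (kernel_mat N e Ks)"
      unfolding Ks_def B.kernel_mat_induced[OF e] by (rule B.walk.diagonalizable_kernel[OF e])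
  next
    show "\<bar>poset_moebius L UNIV W\<bar> = (- 1) ^ codim W * poset_moebius L UNIV W" if "W \<in> L" for W
      using moebius_sign[OF B.arrangement_B] that unfolding L_def .
    show "(\<exists>!p. stationary (chambers B) Ks p) \<longleftrightarrow> (\<forall>H\<in>B. \<exists>F\<in>faces A. \<not> F \<subseteq> H \<and> pmf w F > 0)"
      unfolding Ks by (rule B.ex1_stationary_iff)
    show "\<exists>!p. stationary (chambers A) K p" if "separating A w" by (rule sep_A[OF that])
  next
    fix p pbar D
    assume s: "separating A w" and D: "D \<in> chambers B"
      and st: "stationary (chambers A) K p \<and> stationary (chambers B) Ks pbar"
    have p: "stationary (chambers A) (walk_kernel A w) p" using st unfolding K_def by blast
    \<comment> \<open>The image of a stationary distribution is stationary for the induced chain,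
      where separation gives uniqueness.\<close>
    have "pbar = map_pmf (chamber_containing B) p"
      using sep_B[OF s] st B.stationary_pushforward(1)[OF p] unfolding Ks by blast
    then show "pmf pbar D = (\<Sum>C\<in>{C \<in> chambers A. C \<subseteq> D}. pmf p C)"
      using B.stationary_pushforward(2)[OF p D] by simp
  next
    fix pbar D and l :: nat
    assume "(\<exists>!p. stationary (chambers B) Ks p) \<and> stationary (chambers B) Ks pbar" and D: "D \<in> chambers B"
    then have p: "stationary (chambers B) B.walk.kernel pbar" unfolding Ks by blast
    show "tv_dist (chambers B) (kernel_pow (chambers B) Ks l D) (pmf pbar)
        \<le> measure_pmf.prob (replicate_pmf l w) {Fs. face_prod_list A Fs \<subseteq> \<Union>B}" if "l \<ge> 1"
      unfolding Ks_pow by (rule B.tv_dist_le_prob_face_prod[OF p D that])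
    show "tv_dist (chambers B) (kernel_pow (chambers B) Ks l D) (pmf pbar) \<le> (\<Sum>H\<in>B. face_mass A w H ^ l)"
      unfolding Ks_pow mass by (rule B.walk.tv_dist_le_sum[OF p D])
  qed
qed

end
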